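(* Let $A\in\mathbb{R}^{n\times d}$ be a nonzero matrix with rows $a_1,\dots,a_n$, let $f(x)=\frac1{2n}\|Ax-b\|_2^2$, let $\rho\in[1,n]$ satisfy $$\frac{\max_{i\in[n]}\|a_i\|_2^2}{\frac1n\sum_{j=1}^n\|a_j\|_2^2}\le\rho ,$$ and let $\delta>0$. If $\bar S$ is a uniform random partition of $[n]$ into $K$ subsets of equal size $n/K$, then for $$K\in\left[\frac{\|A\|^2}{\|A^T\|_{1\to2}^2},\ \min(n,d)\right],$$ the following lower bounds hold for the Stochastic Acceleration factor $\Upsilon(A,\bar S,K)$: $$\Upsilon(A,\bar S,K)\;\ge\;\frac{1}{\frac1K+\delta\cdot\frac{\|A^T\|_{1\to2}^2}{\|A\|^2}}\;\ge\;\frac{1}{\frac1K+\delta\cdot\frac\rho n\cdot\frac{\sum_{i=1}^d\sigma(A^TA,i)}{\sigma(A^TA,1)}}$$ with probability at least $1-d^2\left(\frac e\delta\right)^\delta$.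
   Context: $[n]=\{1,\dots,n\}$; $K$ is a positive integer dividing $n$; $\|A\|$ is the spectral norm of $A$; $\|A^T\|_{1\to2}^2:=\max_{i\in[n]}\|a_i\|_2^2$; $\sigma(H,k)$ denotes the $k$-th largest eigenvalue of a symmetric matrix $H$. A uniform random partition $\bar S=[S_1,\dots,S_K]$ is obtained by uniformly randomly permuting the indices $[n]$ and splitting them into $K$ consecutive blocks of size $n/K$. For a partition $\bar S$, let $S^k$ be the row-subsampling operator supported on $S_k$ (so $S^kA$ is the submatrix of $A$ with rows indexed by $S_k$), and $f_{S_k}(x)=\frac{K}{2n}\|S^kAx-S^kb\|_2^2$, so that $f=\frac1K\sum_{k=1}^Kf_{S_k}$. $L_f$ is the gradient-Lipschitz (smoothness) constant of $f$ and $L_b$ is the common gradient-Lipschitz constant of the $f_{S_k}$, i.e. in the least-squares setting $$L_f=\frac1n\|A\|^2,\qquad L_b=\frac Kn\max_{k\in[K]}\|S^kA(S^kA)^T\| .$$ The Stochastic Acceleration (SA) factor is $\Upsilon(A,\bar S,K)=\frac{KL_f}{L_b}$. *)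

theory Defs
  imports "HOL-Probability.Probability" "HOL-Computational_Algebra.Computational_Algebra"
begin

section \<open>Norms and eigenvalues\<close>

definition spectral_norm :: "real^'d^'n \<Rightarrow> real" where
  "spectral_norm A = onorm ((*v) A)"

text \<open>The squared norm \<open>\<parallel>A\<^sup>T\<parallel>\<close> from \<open>l\<^sub>1\<close> to \<open>l\<^sub>2\<close>,
  i.e. the largest squared Euclidean length of a row of \<open>A\<close>.\<close>

definition norm_1_2_transpose_sq :: "real^'d^'n \<Rightarrow> real" where
  "norm_1_2_transpose_sq A = Max (range (\<lambda>i. (norm (row i A))\<^sup>2))"

definition charpoly :: "real^'d^'d \<Rightarrow> real poly" where
  "charpoly H = det (\<chi> i j. (if i = j then [:0, 1:] else 0) - [:H $ i $ j:])"

text \<open>Eigenvalues are counted with multiplicity and numbered from 1 in decreasing order.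
  For symmetric \<open>H\<close> the characteristic polynomial splits over the reals, so that
  \<open>proots (charpoly H)\<close> has \<open>CARD('d)\<close> elements.\<close>

definition \<sigma> :: "real^'d^'d \<Rightarrow> nat \<Rightarrow> real" where
  "\<sigma> H k = rev (sorted_list_of_multiset (proots (charpoly H))) ! (k - 1)"


section \<open>Random partitions\<close>

text \<open>The \<open>k\<close>-th of the consecutive blocks of length \<open>length xs div K\<close> of an ordering \<open>xs\<close>
  of the index set; blocks are numbered \<open>0, \<dots>, K - 1\<close>.\<close>

definition blocks :: "nat \<Rightarrow> 'n list \<Rightarrow> nat \<Rightarrow> 'n set" where
  "blocks K xs k = (let m = length xs div K in set (take m (drop (k * m) xs)))"

definition uniform_partition :: "nat \<Rightarrow> (nat \<Rightarrow> 'n::finite set) pmf" where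
  "uniform_partition K = map_pmf (blocks K) (pmf_of_set (permutations_of_set UNIV))"


section \<open>Least-squares objectives\<close>

text \<open>Row subsampling keeps the shape of its argument and sets the entries outside \<open>S\<close> to 0;
  compared with deleting these rows this changes neither \<open>\<parallel>S A x - S b\<parallel>\<close> nor spectral norms.\<close>

definition subsample :: "'n set \<Rightarrow> ('a::zero)^'n \<Rightarrow> 'a^'n" where
  "subsample S v = (\<chi> i. if i \<in> S then v $ i else 0)"

definition lsq :: "real^'d^'n \<Rightarrow> real^'n \<Rightarrow> real^'d \<Rightarrow> real" where
  "lsq A b x = 1 / (2 * real CARD('n)) * (norm (A *v x - b))\<^sup>2"

definition lsq_block :: "real^'d^'n \<Rightarrow> real^'n \<Rightarrow> nat \<Rightarrow> 'n set \<Rightarrow> real^'d \<Rightarrow> real" where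
  "lsq_block A b K S x =
     real K / (2 * real CARD('n)) * (norm (subsample S A *v x - subsample S b))\<^sup>2"


section \<open>Smoothness constants and the Stochastic Acceleration factor\<close>

definition gradient_lipschitz :: "real \<Rightarrow> ('a::euclidean_space \<Rightarrow> real) \<Rightarrow> bool" where
  "gradient_lipschitz L F \<longleftrightarrow> (\<exists>G. (\<forall>x. GDERIV F x :> G x) \<and> L-lipschitz_on UNIV G)"

text \<open>The smoothness constants are the best possible ones; their closed forms are
  proved below as \<open>L_f_eq\<close> and \<open>L_b_eq\<close>.\<close>

definition L_f :: "real^'d^'n \<Rightarrow> real^'n \<Rightarrow> real" where
  "L_f A b = Inf {L. gradient_lipschitz L (lsq A b)}"

definition L_b :: "real^'d^'n \<Rightarrow> real^'n \<Rightarrow> (nat \<Rightarrow> 'n set) \<Rightarrow> nat \<Rightarrow> real" where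
  "L_b A b S K = Inf {L. \<forall>k<K. gradient_lipschitz L (lsq_block A b K (S k))}"

definition SA_factor :: "real^'d^'n \<Rightarrow> real^'n \<Rightarrow> (nat \<Rightarrow> 'n set) \<Rightarrow> nat \<Rightarrow> real" where
  "SA_factor A b S K = real K * L_f A b / L_b A b S K"


section \<open>Closed forms of the smoothness constants\<close>

lemma norm_matrix_le: "norm ((A::real^'d^'n) *v x) \<le> spectral_norm A * norm x"
  unfolding spectral_norm_def by (intro onorm matrix_vector_mul_bounded_linear)

lemma spectral_norm_nonneg: "0 \<le> spectral_norm A"
  unfolding spectral_norm_def by (intro onorm_pos_le matrix_vector_mul_bounded_linear)

lemma spectral_norm_leI: "(\<And>x. norm ((A::real^'d^'n) *v x) \<le> c * norm x) \<Longrightarrow> spectral_norm A \<le> c"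
  unfolding spectral_norm_def by (rule onorm_le)

lemma spectral_norm_transpose_le: "spectral_norm (transpose A) \<le> spectral_norm (A::real^'d^'n)"
proof (rule spectral_norm_leI)
  fix y :: "real^'n"
  let ?z = "transpose A *v y"
  have "(norm ?z)\<^sup>2 = y \<bullet> (A *v ?z)"
    by (metis dot_lmul_matrix power2_norm_eq_inner vector_transpose_matrix transpose_transpose)
  also have "\<dots> \<le> norm y * norm (A *v ?z)" by (rule norm_cauchy_schwarz)
  also have "\<dots> \<le> norm y * (spectral_norm A * norm ?z)"
    by (intro mult_left_mono norm_matrix_le) auto
  finally have "norm ?z * norm ?z \<le> (spectral_norm A * norm y) * norm ?z"
    by (simp add: power2_eq_square mult_ac)
  then show "norm ?z \<le> spectral_norm A * norm y"
    by (cases "norm ?z = 0")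
      (auto simp: spectral_norm_nonneg mult_le_cancel_right simp del: norm_eq_zero)
qed

lemma spectral_norm_transpose: "spectral_norm (transpose A) = spectral_norm (A::real^'d^'n)"
  by (metis antisym spectral_norm_transpose_le transpose_transpose)

lemma spectral_norm_gram: "spectral_norm (transpose A ** A) = (spectral_norm (A::real^'d^'n))\<^sup>2"
proof (rule antisym)
  show "spectral_norm (transpose A ** A) \<le> (spectral_norm A)\<^sup>2"
  proof (rule spectral_norm_leI)
    fix x
    have "norm (transpose A *v (A *v x)) \<le> spectral_norm A * norm (A *v x)"
      using norm_matrix_le[of "transpose A"] by (simp add: spectral_norm_transpose)
    also have "\<dots> \<le> spectral_norm A * (spectral_norm A * norm x)"
      by (intro mult_left_mono norm_matrix_le spectral_norm_nonneg)
    finally show "norm ((transpose A ** A) *v x) \<le> (spectral_norm A)\<^sup>2 * norm x"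
      by (simp add: matrix_vector_mul_assoc power2_eq_square mult_ac)
  qed
  let ?s = "spectral_norm (transpose A ** A)"
  have "spectral_norm A \<le> sqrt ?s"
  proof (rule spectral_norm_leI)
    fix x
    have "(norm (A *v x))\<^sup>2 = x \<bullet> ((transpose A ** A) *v x)"
      by (metis dot_lmul_matrix matrix_vector_mul_assoc power2_norm_eq_inner
          vector_transpose_matrix transpose_transpose)
    also have "\<dots> \<le> norm x * norm ((transpose A ** A) *v x)" by (rule norm_cauchy_schwarz)
    also have "\<dots> \<le> norm x * (?s * norm x)"
      by (intro mult_left_mono norm_matrix_le) auto
    also have "\<dots> = (sqrt ?s * norm x)\<^sup>2"
      by (simp add: power_mult_distrib spectral_norm_nonneg power2_eq_square)
    finally show "norm (A *v x) \<le> sqrt ?s * norm x"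
      by (rule power2_le_imp_le) (simp add: spectral_norm_nonneg)
  qed
  then have "(spectral_norm A)\<^sup>2 \<le> (sqrt ?s)\<^sup>2"
    by (intro power_mono spectral_norm_nonneg)
  then show "(spectral_norm A)\<^sup>2 \<le> ?s" by (simp add: spectral_norm_nonneg)
qed

lemma spectral_norm_gram': "spectral_norm (A ** transpose A) = (spectral_norm (A::real^'d^'n))\<^sup>2"
  using spectral_norm_gram[of "transpose A"] by (simp add: spectral_norm_transpose)

lemma gradient_lipschitz_quadratic:
  fixes B :: "real^'d^'n"
  assumes c: "0 \<le> c"
  shows "gradient_lipschitz L (\<lambda>x. c / 2 * (norm (B *v x - y))\<^sup>2) \<longleftrightarrow> c * (spectral_norm B)\<^sup>2 \<le> L"
proof -
  let ?F = "\<lambda>x. c / 2 * (norm (B *v x - y))\<^sup>2"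
  define G where "G x = c *\<^sub>R (transpose B *v (B *v x - y))" for x
  have adj: "u \<bullet> (B *v h) = h \<bullet> (transpose B *v u)" for u h
    by (metis dot_lmul_matrix inner_commute vector_transpose_matrix transpose_transpose)
  have GD: "GDERIV ?F x :> G x" for x
    unfolding gderiv_def power2_norm_eq_inner
    by (auto intro!: derivative_eq_intros bounded_linear.has_derivative[OF matrix_vector_mul_bounded_linear]
        simp: G_def adj inner_commute[of "B *v _"])
  have diff: "norm (G x - G z) = c * norm ((transpose B ** B) *v (x - z))" for x z
    using c by (simp add: G_def matrix_vector_mult_diff_distrib matrix_vector_mul_assoc
        flip: scaleR_diff_right)
  have "gradient_lipschitz L ?F \<longleftrightarrow> L-lipschitz_on UNIV G"
  proof
    assume "gradient_lipschitz L ?F"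
    then obtain G' where G': "\<And>x. GDERIV ?F x :> G' x" "L-lipschitz_on UNIV G'"
      unfolding gradient_lipschitz_def by blast
    have "G' x = G x" for x
    proof -
      have "(\<lambda>h. h \<bullet> G' x) = (\<lambda>h. h \<bullet> G x)"
        using has_derivative_unique G'(1)[of x] GD[of x] unfolding gderiv_def by blast
      then show ?thesis by (metis vector_eq_ldot)
    qed
    with G'(2) show "L-lipschitz_on UNIV G" by (simp add: lipschitz_on_def)
  qed (use GD in \<open>auto simp: gradient_lipschitz_def\<close>)
  also have "\<dots> \<longleftrightarrow> c * (spectral_norm B)\<^sup>2 \<le> L"
  proof
    assume lip: "L-lipschitz_on UNIV G"
    have *: "c * norm ((transpose B ** B) *v x) \<le> L * norm x" for x
      using lipschitz_onD[OF lip, of x 0] by (simp only: dist_norm diff) simp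
    show "c * (spectral_norm B)\<^sup>2 \<le> L"
    proof (cases "c = 0")
      case True
      then show ?thesis using lipschitz_on_nonneg[OF lip] by simp
    next
      case False
      with c have "spectral_norm (transpose B ** B) \<le> L / c"
        by (intro spectral_norm_leI) (use * in \<open>simp add: field_simps\<close>)
      with False c show ?thesis by (simp add: spectral_norm_gram field_simps)
    qed
  next
    assume L: "c * (spectral_norm B)\<^sup>2 \<le> L"
    show "L-lipschitz_on UNIV G"
    proof (rule lipschitz_onI)
      fix x z
      have "dist (G x) (G z) \<le> c * ((spectral_norm B)\<^sup>2 * norm (x - z))"
        unfolding dist_norm diff using c norm_matrix_le[of "transpose B ** B" "x - z"]
        by (intro mult_left_mono) (simp_all add: spectral_norm_gram)
      also have "\<dots> \<le> L * norm (x - z)" using mult_right_mono[OF L, of "norm (x - z)"]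
        by (simp add: mult_ac)
      finally show "dist (G x) (G z) \<le> L * dist x z" by (simp add: dist_norm)
    next
      show "0 \<le> L" using L c by (meson mult_nonneg_nonneg order_trans zero_le_power2)
    qed
  qed
  finally show ?thesis .
qed

lemma L_f_eq: "L_f (A::real^'d^'n) b = 1 / real CARD('n) * (spectral_norm A)\<^sup>2"
proof -
  have "lsq A b = (\<lambda>x. (1 / real CARD('n)) / 2 * (norm (A *v x - b))\<^sup>2)"
    by (simp add: fun_eq_iff lsq_def)
  then have "{L. gradient_lipschitz L (lsq A b)} = {1 / real CARD('n) * (spectral_norm A)\<^sup>2..}"
    using gradient_lipschitz_quadratic[of "1 / real CARD('n)" _ A b] by auto
  then show ?thesis unfolding L_f_def by (simp only: cInf_atLeast)
qed

lemma L_b_eq: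
  fixes A :: "real^'d^'n"
  assumes K: "K > 0"
  shows "L_b A b S K = real K / real CARD('n) *
           (MAX k\<in>{..<K}. spectral_norm (subsample (S k) A ** transpose (subsample (S k) A)))"
    (is "_ = ?c * ?M")
proof -
  have c: "?c > 0" using K by simp
  have "lsq_block A b K T = (\<lambda>x. ?c / 2 * (norm (subsample T A *v x - subsample T b))\<^sup>2)" for T
    by (simp add: fun_eq_iff lsq_block_def)
  then have *: "gradient_lipschitz L (lsq_block A b K T) \<longleftrightarrow>
      ?c * spectral_norm (subsample T A ** transpose (subsample T A)) \<le> L" for L T
    using gradient_lipschitz_quadratic[of ?c L "subsample T A" "subsample T b"]
    by (simp only: spectral_norm_gram') simp
  have "(\<forall>k<K. ?c * spectral_norm (subsample (S k) A ** transpose (subsample (S k) A)) \<le> L)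
      \<longleftrightarrow> ?c * ?M \<le> L" for L
  proof -
    have "?c * u \<le> L \<longleftrightarrow> u \<le> L / ?c" for u
      using pos_le_divide_eq[OF c, of u L] by (metis mult.commute)
    moreover have "?M \<le> L / ?c \<longleftrightarrow>
        (\<forall>k<K. spectral_norm (subsample (S k) A ** transpose (subsample (S k) A)) \<le> L / ?c)"
      using K by (subst Max_le_iff) auto
    ultimately show ?thesis by simp
  qed
  then have "{L. \<forall>k<K. gradient_lipschitz L (lsq_block A b K (S k))} = {?c * ?M..}"
    unfolding * by auto
  then show ?thesis unfolding L_b_def by (simp only: cInf_atLeast)
qed

end

theory Submission
  imports Defs
begin

text \<open>
  Since \<open>\<Upsilon> = \<parallel>A\<parallel>\<^sup>2 / max\<^sub>k \<parallel>S\<^sup>k A\<parallel>\<^sup>2\<close>, it suffices by a union bound to show that a uniformly random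
  set \<open>S\<close> of \<open>n/K\<close> rows satisfies \<open>\<parallel>S A\<parallel>\<^sup>2 \<le> \<parallel>A\<parallel>\<^sup>2/K + \<delta> R\<close>, \<open>R = max \<parallel>a\<^sub>i\<parallel>\<^sup>2\<close>, up to probability
  \<open>d (e/\<delta>)\<^sup>\<delta>\<close>. This is a matrix Chernoff bound for sampling without replacement. As the summands
  \<open>a a\<^sup>T\<close> have rank one, neither Lieb's theorem nor the Golden--Thompson inequality is needed:
  comparing power series coefficientwise gives
  \<open>tr exp (N + aa\<^sup>T) \<le> tr exp N + (e\<^sup>r - 1)/r \<cdot> a\<^sup>T (exp N) a\<close> for \<open>N \<ge> 0\<close> and \<open>a\<^sup>T a \<le> r\<close>. When \<open>a\<close> is a
  uniformly random row outside the set \<open>T\<close> chosen so far, monotonicity of the exponential under the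
  trace shows that on average \<open>a\<^sup>T (exp N) a\<close> is at most its mean over all rows, which is
  bounded by \<open>\<parallel>A\<parallel>\<^sup>2/n \<cdot> tr exp N\<close>. Iterating over the size of the set bounds the mean of \<open>tr exp\<close>, and
  Markov's inequality finishes the argument.
\<close>

subsection \<open>Orthonormal eigenbases\<close>

text \<open>Unit length and pairwise orthogonality make \<open>B\<close> an orthonormal basis. The
  eigenvalue of \<open>u\<close> is recovered as the Rayleigh quotient
  \<open>f u \<bullet> u\<close>, so a plain set of vectors records all eigenvalues with
  multiplicity.\<close>

definition eigenbasis :: "('a::euclidean_space \<Rightarrow> 'a) \<Rightarrow> 'a set \<Rightarrow> bool" where
  "eigenbasis f B \<longleftrightarrow> finite B \<and> pairwise orthogonal B \<and> span B = UNIV \<and>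
     (\<forall>u\<in>B. norm u = 1 \<and> f u = (f u \<bullet> u) *\<^sub>R u)"

text \<open>Divide by \<open>t\<close> and let \<open>t\<close> tend to 0. This is the first-order
  condition at a maximum, used below in place of differentiation.\<close>

lemma zero_if_linear_le_quadratic:
  fixes a c :: real
  assumes "\<And>t. t > 0 \<Longrightarrow> t * a \<le> t\<^sup>2 * c" and "a \<ge> 0"
  shows "a = 0"
proof (rule ccontr)
  assume "a \<noteq> 0"
  with assms(2) have a: "a > 0" by simp
  define t where "t = a / (2 * (\<bar>c\<bar> + 1))"
  have t: "t > 0" using a by (simp add: t_def)
  have "a \<le> t * c"
    using assms(1)[OF t] t by (simp add: power2_eq_square mult.assoc)
  also have "\<dots> \<le> t * (\<bar>c\<bar> + 1)" using t by (intro mult_left_mono) auto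
  also have "\<dots> = a / 2" by (simp add: t_def field_simps)
  finally show False using a by simp
qed

text \<open>A maximiser \<open>u\<close> of the Rayleigh quotient on the compact unit sphere of
  \<open>S\<close> is an eigenvector: perturbing \<open>u\<close> along the residual
  \<open>w = f u - l u\<close> would otherwise increase the quotient.\<close>

lemma symmetric_eigenvector:
  fixes f :: "'a::euclidean_space \<Rightarrow> 'a"
  assumes lin: "linear f" and sym: "\<And>x y. f x \<bullet> y = x \<bullet> f y"
    and S: "subspace S" "\<And>x. x \<in> S \<Longrightarrow> f x \<in> S" "S \<noteq> {0}"
  obtains u where "u \<in> S" "norm u = 1" "f u = (f u \<bullet> u) *\<^sub>R u"
proof -
  let ?C = "sphere 0 1 \<inter> S"
  have "compact ?C" using S by (intro compact_Int_closed closed_subspace) auto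
  moreover have "?C \<noteq> {}"
  proof -
    obtain x where "x \<in> S" "x \<noteq> 0" using S subspace_0 by fastforce
    then have "x /\<^sub>R norm x \<in> ?C" using S by (simp add: subspace_scale)
    then show ?thesis by blast
  qed
  moreover have "continuous_on ?C (\<lambda>x. f x \<bullet> x)"
    by (intro continuous_intros linear_continuous_on linear_conv_bounded_linear[THEN iffD1] lin)
  ultimately have "\<exists>u\<in>?C. \<forall>x\<in>?C. f x \<bullet> x \<le> f u \<bullet> u"
    by (rule continuous_attains_sup)
  then obtain u where u: "u \<in> ?C" and max: "\<And>x. x \<in> ?C \<Longrightarrow> f x \<bullet> x \<le> f u \<bullet> u"
    by blast
  define l where "l = f u \<bullet> u"
  define w where "w = f u - l *\<^sub>R u"
  have le: "f x \<bullet> x \<le> l * (x \<bullet> x)" if "x \<in> S" for x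
  proof (cases "x = 0")
    case False
    then have "x /\<^sub>R norm x \<in> ?C" using S that by (simp add: subspace_scale)
    from max[OF this] have "(f x \<bullet> x) / (norm x)\<^sup>2 \<le> l"
      by (simp add: l_def linear_cmul[OF lin] power2_eq_square field_simps)
    with False show ?thesis by (simp add: field_simps flip: power2_norm_eq_inner)
  qed (simp add: linear_0[OF lin])
  have uu: "u \<bullet> u = 1" using u by (simp add: norm_eq_1)
  have wu: "w \<bullet> u = 0" by (simp add: w_def l_def inner_diff_left uu)
  have fuw: "f u \<bullet> w = w \<bullet> w" using wu by (simp add: w_def inner_diff_left inner_diff_right inner_commute)
  have wS: "w \<in> S" using u S by (auto simp: w_def intro!: subspace_diff subspace_scale)
  \<comment> \<open>Expanding the quadratic form at \<open>u + t *\<^sub>R w\<close>: the linear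
    term in \<open>t\<close> is \<open>2 * (w \<bullet> w)\<close>, because \<open>w\<close> is
    orthogonal to \<open>u\<close> and \<open>f u \<bullet> w = w \<bullet> w\<close>.\<close>
  have "t * (2 * (w \<bullet> w)) \<le> t\<^sup>2 * (l * (w \<bullet> w) - f w \<bullet> w)" for t
  proof -
    have "u + t *\<^sub>R w \<in> S" using u wS S by (auto intro!: subspace_add subspace_scale)
    from le[OF this] show ?thesis
      using wu fuw uu sym[of w u]
      by (simp add: linear_add[OF lin] linear_cmul[OF lin] inner_add_left inner_add_right
          inner_commute l_def power2_eq_square algebra_simps)
  qed
  then have "2 * (w \<bullet> w) = 0" by (intro zero_if_linear_le_quadratic) auto
  then have "f u = (f u \<bullet> u) *\<^sub>R u" by (simp add: w_def l_def)
  with u that show thesis by auto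
qed

text \<open>Induction on the dimension: split off one unit eigenvector \<open>u\<close>. By symmetry
  of \<open>f\<close>, the orthogonal complement of \<open>u\<close> in \<open>S\<close> is again
  invariant.\<close>

lemma symmetric_eigenbasis_subspace:
  fixes f :: "'a::euclidean_space \<Rightarrow> 'a"
  assumes lin: "linear f" and sym: "\<And>x y. f x \<bullet> y = x \<bullet> f y"
    and S: "subspace S" "\<And>x. x \<in> S \<Longrightarrow> f x \<in> S"
  shows "\<exists>B. finite B \<and> pairwise orthogonal B \<and> span B = S \<and>
     (\<forall>u\<in>B. norm u = 1 \<and> f u = (f u \<bullet> u) *\<^sub>R u)"
  using S
proof (induction "dim S" arbitrary: S rule: less_induct)
  case less
  show ?case
  proof (cases "S = {0}")
    case True
    then show ?thesis by (intro exI[of _ "{}"]) auto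
  next
    case False
    then obtain u where u: "u \<in> S" "norm u = 1" "f u = (f u \<bullet> u) *\<^sub>R u"
      using symmetric_eigenvector[OF lin sym less.prems] by metis
    define S' where "S' = S \<inter> {x. u \<bullet> x = 0}"
    have sub: "subspace S'" unfolding S'_def
      using less.prems(1) by (rule subspace_inter) (rule subspace_hyperplane)
    have uu: "u \<bullet> u = 1" using u by (simp add: norm_eq_1)
    then have "u \<notin> S'" by (simp add: S'_def)
    with u have "S' \<subset> S" unfolding S'_def by blast
    then have dim: "dim S' < dim S"
      using dim_psubset sub less.prems(1) by (metis span_eq_iff)
    have inv: "f x \<in> S'" if "x \<in> S'" for x
    proof -
      have "u \<bullet> f x = f u \<bullet> x" by (simp add: sym)
      also have "\<dots> = (f u \<bullet> u) * (u \<bullet> x)" using u(3) by (metis inner_scaleR_left)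
      also have "\<dots> = 0" using that by (simp add: S'_def)
      finally show ?thesis using that less.prems by (auto simp: S'_def)
    qed
    obtain B where B: "finite B" "pairwise orthogonal B" "span B = S'"
       "\<And>v. v \<in> B \<Longrightarrow> norm v = 1 \<and> f v = (f v \<bullet> v) *\<^sub>R v"
      using less.hyps[OF dim sub inv] by blast
    have BS: "B \<subseteq> S'" using B(3) span_superset by blast
    have "span (insert u B) = S"
    proof
      show "span (insert u B) \<subseteq> S"
        using BS u less.prems by (intro span_minimal) (auto simp: S'_def)
      show "S \<subseteq> span (insert u B)"
      proof
        fix x assume x: "x \<in> S"
        have "x - (u \<bullet> x) *\<^sub>R u \<in> S'"
          using x u less.prems uu by (auto simp: S'_def inner_diff_right intro!: subspace_diff subspace_scale)
        then show "x \<in> span (insert u B)" unfolding span_insert B(3) by auto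
      qed
    qed
    moreover have "pairwise orthogonal (insert u B)"
      using B(2) BS by (auto simp: pairwise_insert S'_def orthogonal_def inner_commute)
    ultimately show ?thesis using B u by (intro exI[of _ "insert u B"]) auto
  qed
qed

lemma symmetric_eigenbasis:
  fixes f :: "'a::euclidean_space \<Rightarrow> 'a"
  assumes "linear f" "\<And>x y. f x \<bullet> y = x \<bullet> f y"
  shows "\<exists>B. eigenbasis f B"
  using symmetric_eigenbasis_subspace[OF assms subspace_UNIV] by (auto simp: eigenbasis_def)

lemma eigenbasis_expand:
  assumes "eigenbasis f B"
  shows "(\<Sum>u\<in>B. (x \<bullet> u) *\<^sub>R u) = x"
  using assms by (intro orthonormal_basis_expand) (auto simp: eigenbasis_def)

lemma eigenbasis_inner:
  assumes "eigenbasis f B"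
  shows "x \<bullet> y = (\<Sum>u\<in>B. (x \<bullet> u) * (y \<bullet> u))"
proof -
  have "x \<bullet> y = x \<bullet> (\<Sum>u\<in>B. (y \<bullet> u) *\<^sub>R u)" by (simp add: eigenbasis_expand[OF assms])
  then show ?thesis by (simp add: inner_sum_right mult.commute)
qed

section \<open>Powers and their traces in an eigenbasis\<close>

lemma linear_funpow: "linear f \<Longrightarrow> linear (f ^^ p)" for f :: "'a::real_vector \<Rightarrow> 'a"
  by (induction p) (auto intro: linear_compose simp: linear_id[unfolded id_def] id_def)

lemma funpow_eigenvector:
  fixes f :: "'a::real_vector \<Rightarrow> 'a"
  assumes "linear f" "f u = l *\<^sub>R u"
  shows "(f ^^ p) u = l ^ p *\<^sub>R u"
  using assms by (induction p) (auto simp: linear_cmul)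

lemma eigenbasis_funpow:
  assumes "eigenbasis f B" "linear f"
  shows "x \<bullet> (f ^^ p) y = (\<Sum>u\<in>B. (x \<bullet> u) * (y \<bullet> u) * (f u \<bullet> u) ^ p)"
proof -
  have "(f ^^ p) y = (f ^^ p) (\<Sum>u\<in>B. (y \<bullet> u) *\<^sub>R u)" by (simp add: eigenbasis_expand[OF assms(1)])
  also have "\<dots> = (\<Sum>u\<in>B. (y \<bullet> u) *\<^sub>R (f ^^ p) u)"
    by (simp add: linear_sum[OF linear_funpow[OF assms(2)]] linear_cmul[OF linear_funpow[OF assms(2)]])
  also have "\<dots> = (\<Sum>u\<in>B. (y \<bullet> u) *\<^sub>R ((f u \<bullet> u) ^ p *\<^sub>R u))"
    using assms by (intro sum.cong refl arg_cong2[where f = scaleR] funpow_eigenvector)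
      (auto simp: eigenbasis_def)
  finally show ?thesis by (simp add: inner_sum_right mult_ac)
qed

text \<open>The left side is the trace in the standard basis. It does not mention \<open>B\<close>,
  so traces of powers of two operators can be compared although their eigenbases differ.\<close>

lemma eigenbasis_trace:
  assumes "eigenbasis f B" "linear f"
  shows "(\<Sum>e\<in>Basis. e \<bullet> (f ^^ p) e) = (\<Sum>u\<in>B. (f u \<bullet> u) ^ p)"
proof -
  have "(\<Sum>e\<in>Basis. e \<bullet> (f ^^ p) e) = (\<Sum>u\<in>B. (\<Sum>e\<in>Basis. (u \<bullet> e) * (u \<bullet> e)) * (f u \<bullet> u) ^ p)"
    unfolding eigenbasis_funpow[OF assms] by (subst sum.swap) (simp add: sum_distrib_right inner_commute)
  also have "\<dots> = (\<Sum>u\<in>B. (f u \<bullet> u) ^ p)"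
    using assms(1) by (intro sum.cong refl) (auto simp: eigenbasis_def norm_eq_1 simp flip: euclidean_inner)
  finally show ?thesis .
qed

lemma card_eigenbasis:
  fixes f :: "'a::euclidean_space \<Rightarrow> 'a"
  assumes "eigenbasis f B"
  shows "card B = DIM('a)"
proof -
  \<comment> \<open>\<open>B\<close> is also an eigenbasis of the identity; the trace of its zeroth
    power, computed in both bases, counts \<open>B\<close> and gives the dimension.\<close>
  have "eigenbasis (\<lambda>x. x) B" using assms by (auto simp: eigenbasis_def norm_eq_1)
  from eigenbasis_trace[OF this linear_id[unfolded id_def], of 0] show ?thesis
    by (simp add: of_nat_eq_iff[where 'a = real, symmetric] del: of_nat_eq_iff)
qed

subsection \<open>The trace exponential under rank one updates\<close>

definition symmetric_op :: "('a::euclidean_space \<Rightarrow> 'a) \<Rightarrow> bool" where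
  "symmetric_op f \<longleftrightarrow> linear f \<and> (\<forall>x y. f x \<bullet> y = x \<bullet> f y)"

definition psd_op :: "('a::euclidean_space \<Rightarrow> 'a) \<Rightarrow> bool" where
  "psd_op f \<longleftrightarrow> symmetric_op f \<and> (\<forall>x. 0 \<le> f x \<bullet> x)"

definition some_eigenbasis :: "('a::euclidean_space \<Rightarrow> 'a) \<Rightarrow> 'a set" where
  "some_eigenbasis f = (SOME B. eigenbasis f B)"

text \<open>\<open>trace_exp f\<close> is \<open>tr (exp f)\<close> and \<open>exp_form f a\<close> is \<open>a\<^sup>T (exp f) a\<close>, both meaningful for
  symmetric \<open>f\<close> only; without an eigenbasis the choice in \<open>some_eigenbasis\<close> is arbitrary.\<close>

definition trace_exp :: "('a::euclidean_space \<Rightarrow> 'a) \<Rightarrow> real" where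
  "trace_exp f = (\<Sum>u\<in>some_eigenbasis f. exp (f u \<bullet> u))"

definition exp_form :: "('a::euclidean_space \<Rightarrow> 'a) \<Rightarrow> 'a \<Rightarrow> real" where
  "exp_form f a = (\<Sum>u\<in>some_eigenbasis f. (a \<bullet> u)\<^sup>2 * exp (f u \<bullet> u))"

lemma eigenbasis_some_eigenbasis: "symmetric_op f \<Longrightarrow> eigenbasis f (some_eigenbasis f)"
  unfolding some_eigenbasis_def symmetric_op_def by (rule someI_ex, rule symmetric_eigenbasis) auto

text \<open>The power series of the exponential, summed over the eigenvalues. It reduces
  inequalities between trace exponentials to inequalities between traces of powers.\<close>

lemma trace_exp_sums:
  assumes "symmetric_op f"
  shows "(\<lambda>p. (\<Sum>e\<in>Basis. e \<bullet> (f ^^ p) e) /\<^sub>R fact p) sums trace_exp f"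
proof -
  have "(\<lambda>p. \<Sum>u\<in>some_eigenbasis f. (f u \<bullet> u) ^ p /\<^sub>R fact p) sums trace_exp f"
    unfolding trace_exp_def by (intro sums_sum exp_converges)
  then show ?thesis
    using assms by (simp add: eigenbasis_trace[OF eigenbasis_some_eigenbasis] symmetric_op_def
        sum_distrib_left)
qed

text \<open>Telescoping: \<open>H^p - N^p\<close> is the sum over \<open>j < p\<close> of
  \<open>H^j (H - N) N^(p-1-j)\<close>, and \<open>H - N\<close> is the rank one operator
  \<open>a a\<^sup>T\<close>, which splits each term into a product of two scalars.\<close>

lemma funpow_rank_one_update:
  fixes H N :: "'a::real_inner \<Rightarrow> 'a"
  assumes "linear H" "\<And>x. H x = N x + (a \<bullet> x) *\<^sub>R a"
  shows "x \<bullet> (H ^^ p) y = x \<bullet> (N ^^ p) y +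
     (\<Sum>j<p. (x \<bullet> (H ^^ j) a) * (a \<bullet> (N ^^ (p - Suc j)) y))"
proof (induction p arbitrary: y)
  case (Suc p)
  have "x \<bullet> (H ^^ Suc p) y = x \<bullet> (H ^^ p) (N y) + (a \<bullet> y) * (x \<bullet> (H ^^ p) a)"
    unfolding funpow_Suc_right o_def assms(2)[of y]
    by (simp only: linear_add[OF linear_funpow[OF assms(1)]] linear_cmul[OF linear_funpow[OF assms(1)]]
        inner_add_right inner_scaleR_right)
  moreover have "(N ^^ (p - Suc j)) (N y) = (N ^^ (p - j)) y" if "j < p" for j
    using that by (metis Suc_diff_Suc comp_apply funpow_Suc_right)
  ultimately show ?case
    by (simp add: Suc.IH funpow_swap1)
qed simp

text \<open>Symmetrisation: the nonnegative double sum of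
  \<open>w u * w v * ((f u - f v) * (g u - g v))\<close> expands to twice the difference of the two
  sides.\<close>

lemma weighted_Chebyshev_sum:
  fixes w f g :: "'b \<Rightarrow> real"
  assumes "\<And>u. u \<in> B \<Longrightarrow> 0 \<le> w u"
    and "\<And>u v. u \<in> B \<Longrightarrow> v \<in> B \<Longrightarrow> 0 \<le> (f u - f v) * (g u - g v)"
  shows "(\<Sum>u\<in>B. w u * f u) * (\<Sum>u\<in>B. w u * g u) \<le> (\<Sum>u\<in>B. w u) * (\<Sum>u\<in>B. w u * (f u * g u))"
proof -
  have "0 \<le> (\<Sum>u\<in>B. \<Sum>v\<in>B. w u * w v * ((f u - f v) * (g u - g v)))"
    using assms by (intro sum_nonneg mult_nonneg_nonneg[of "w _ * w _"]) auto
  also have "\<dots> = (\<Sum>u\<in>B. \<Sum>v\<in>B. w v * (w u * (f u * g u)) + w u * (w v * (f v * g v))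
       - w u * f u * (w v * g v) - w v * f v * (w u * g u))"
    by (intro sum.cong refl) (simp add: algebra_simps)
  also have "\<dots> = 2 * ((\<Sum>u\<in>B. w u) * (\<Sum>u\<in>B. w u * (f u * g u))
       - (\<Sum>u\<in>B. w u * f u) * (\<Sum>u\<in>B. w u * g u))"
    by (simp add: sum.distrib sum_subtractf flip: sum_distrib_left sum_distrib_right)
  finally show ?thesis by simp
qed

text \<open>The induction peels off the outermost factor \<open>H = N + aa\<^sup>T\<close>; Chebyshev's sum inequality
  bounds the resulting product of two moments of \<open>N\<close> by \<open>a \<bullet> a\<close> times a single one.\<close>

lemma rank_one_update_moment_le:
  assumes N: "psd_op N" and H: "linear H" "\<And>x. H x = N x + (a \<bullet> x) *\<^sub>R a" and r: "a \<bullet> a \<le> r"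
    and B: "eigenbasis N B"
  shows "a \<bullet> (N ^^ i) ((H ^^ j) a) \<le> (\<Sum>u\<in>B. (a \<bullet> u)\<^sup>2 * ((N u \<bullet> u) ^ i * (N u \<bullet> u + r) ^ j))"
proof (induction j arbitrary: i)
  case 0
  show ?case
    using N by (simp add: eigenbasis_funpow[OF B] psd_op_def symmetric_op_def power2_eq_square)
next
  case (Suc j)
  let ?w = "\<lambda>u. (a \<bullet> u)\<^sup>2" and ?l = "\<lambda>u. N u \<bullet> u"
  have lin: "linear N" using N by (simp add: psd_op_def symmetric_op_def)
  have l: "0 \<le> ?l u" for u using N by (simp add: psd_op_def)
  have r0: "0 \<le> r" using r inner_ge_zero order_trans by blast
  have "a \<bullet> (N ^^ i) ((H ^^ Suc j) a) =
      a \<bullet> (N ^^ Suc i) ((H ^^ j) a) + (a \<bullet> (H ^^ j) a) * (a \<bullet> (N ^^ i) a)"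
    unfolding funpow.simps(2)[of j H] o_def H(2)[of "(H ^^ j) a"]
    by (simp only: linear_add[OF linear_funpow[OF lin]] linear_cmul[OF linear_funpow[OF lin]]
        inner_add_right inner_scaleR_right funpow_Suc_right o_def)
  also have "\<dots> \<le> (\<Sum>u\<in>B. ?w u * (?l u ^ Suc i * (?l u + r) ^ j)) +
      (\<Sum>u\<in>B. ?w u * (?l u + r) ^ j) * (\<Sum>u\<in>B. ?w u * ?l u ^ i)"
  proof (intro add_mono mult_mono)
    show "a \<bullet> (N ^^ i) a \<le> (\<Sum>u\<in>B. ?w u * ?l u ^ i)"
      by (simp add: eigenbasis_funpow[OF B lin] power2_eq_square)
    show "0 \<le> a \<bullet> (N ^^ i) a"
      using l by (simp add: eigenbasis_funpow[OF B lin] sum_nonneg)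
    show "0 \<le> (\<Sum>u\<in>B. ?w u * (?l u + r) ^ j)"
      using l r0 by (intro sum_nonneg) auto
    show "a \<bullet> (N ^^ Suc i) ((H ^^ j) a) \<le> (\<Sum>u\<in>B. ?w u * (?l u ^ Suc i * (?l u + r) ^ j))"
      by (rule Suc.IH)
    show "a \<bullet> (H ^^ j) a \<le> (\<Sum>u\<in>B. ?w u * (?l u + r) ^ j)"
      using Suc.IH[of 0] by simp
  qed
  \<comment> \<open>Both \<open>(l + r) ^ j\<close> and \<open>l ^ i\<close> increase with
    \<open>l \<ge> 0\<close>, so they are similarly ordered and Chebyshev's inequality
    applies.\<close>
  also have "(\<Sum>u\<in>B. ?w u * (?l u + r) ^ j) * (\<Sum>u\<in>B. ?w u * ?l u ^ i) \<le>
      (\<Sum>u\<in>B. ?w u) * (\<Sum>u\<in>B. ?w u * ((?l u + r) ^ j * ?l u ^ i))"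
  proof (intro weighted_Chebyshev_sum)
    fix u v
    show "0 \<le> ((?l u + r) ^ j - (?l v + r) ^ j) * (?l u ^ i - ?l v ^ i)"
    proof (cases "?l u \<le> ?l v")
      case True
      then have "(?l u + r) ^ j \<le> (?l v + r) ^ j" "?l u ^ i \<le> ?l v ^ i"
        using l r0 by (auto intro!: power_mono)
      then show ?thesis by (simp add: mult_nonpos_nonpos)
    next
      case False
      then have "(?l u + r) ^ j \<ge> (?l v + r) ^ j" "?l u ^ i \<ge> ?l v ^ i"
        using l r0 by (auto intro!: power_mono)
      then show ?thesis by simp
    qed
  qed simp
  also have "(\<Sum>u\<in>B. ?w u) = a \<bullet> a"
    by (simp add: eigenbasis_inner[OF B, of a a] power2_eq_square)
  also have "a \<bullet> a * (\<Sum>u\<in>B. ?w u * ((?l u + r) ^ j * ?l u ^ i)) \<le>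
      r * (\<Sum>u\<in>B. ?w u * ((?l u + r) ^ j * ?l u ^ i))"
    using l r0 by (intro mult_right_mono r sum_nonneg mult_nonneg_nonneg) auto
  \<comment> \<open>The two remaining sums combine by
    \<open>l ^ Suc i + r * l ^ i = l ^ i * (l + r)\<close>.\<close>
  finally show ?case
    by (simp add: sum_distrib_left algebra_simps flip: sum.distrib)
qed

text \<open>After the moment bound, \<open>r\<close> times the telescoped sum is a geometric sum,
  equal to \<open>(l + r) ^ p - l ^ p\<close> for each eigenvalue \<open>l\<close> of
  \<open>N\<close>. Dividing by \<open>fact p\<close> and summing over \<open>p\<close> yields
  \<open>exp (l + r) - exp l = (exp r - 1) * exp l\<close>.\<close>

lemma trace_exp_rank_one_update:
  assumes N: "psd_op N" and H: "symmetric_op H" "\<And>x. H x = N x + (a \<bullet> x) *\<^sub>R a"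
    and r: "a \<bullet> a \<le> r" "0 < r"
  shows "trace_exp H \<le> trace_exp N + (exp r - 1) / r * exp_form N a"
proof -
  let ?B = "some_eigenbasis N"
  let ?w = "\<lambda>u. (a \<bullet> u)\<^sup>2" and ?l = "\<lambda>u. N u \<bullet> u"
  have symN: "symmetric_op N" using N by (simp add: psd_op_def)
  note B = eigenbasis_some_eigenbasis[OF symN]
  have lin: "linear N" "linear H" using symN H by (auto simp: symmetric_op_def)
  have le: "r * ((\<Sum>e\<in>Basis. e \<bullet> (H ^^ p) e) - (\<Sum>e\<in>Basis. e \<bullet> (N ^^ p) e)) \<le>
      (\<Sum>u\<in>?B. ?w u * ((?l u + r) ^ p - ?l u ^ p))" for p
  proof -
    have "(\<Sum>e\<in>Basis. e \<bullet> (H ^^ p) e) - (\<Sum>e\<in>Basis. e \<bullet> (N ^^ p) e) =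
        (\<Sum>j<p. \<Sum>e\<in>Basis. (e \<bullet> (H ^^ j) a) * (a \<bullet> (N ^^ (p - Suc j)) e))"
      unfolding funpow_rank_one_update[OF lin(2) H(2), of _ p]
      by (simp add: sum.distrib) (rule sum.swap)
    \<comment> \<open>Cyclicity of the trace: moving the self-adjoint power of \<open>N\<close> onto
      \<open>a\<close> leaves a Parseval sum over the standard basis.\<close>
    also have "\<dots> = (\<Sum>j<p. a \<bullet> (N ^^ (p - Suc j)) ((H ^^ j) a))"
    proof (intro sum.cong refl)
      fix j
      have sym: "x \<bullet> (N ^^ q) y = y \<bullet> (N ^^ q) x" for x y q
        unfolding eigenbasis_funpow[OF B lin(1)] by (intro sum.cong refl) simp
      have "(\<Sum>e\<in>Basis. (e \<bullet> (H ^^ j) a) * (a \<bullet> (N ^^ (p - Suc j)) e)) =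
          (\<Sum>e\<in>Basis. ((H ^^ j) a \<bullet> e) * ((N ^^ (p - Suc j)) a \<bullet> e))"
        by (intro sum.cong refl) (simp add: sym[of a] inner_commute)
      also have "\<dots> = (H ^^ j) a \<bullet> (N ^^ (p - Suc j)) a" by (rule euclidean_inner[symmetric])
      finally show "(\<Sum>e\<in>Basis. (e \<bullet> (H ^^ j) a) * (a \<bullet> (N ^^ (p - Suc j)) e)) =
          a \<bullet> (N ^^ (p - Suc j)) ((H ^^ j) a)" by (simp add: sym)
    qed
    also have "\<dots> \<le> (\<Sum>j<p. \<Sum>u\<in>?B. ?w u * (?l u ^ (p - Suc j) * (?l u + r) ^ j))"
      by (intro sum_mono rank_one_update_moment_le[OF N lin(2) H(2) r(1) B])
    finally have "r * ((\<Sum>e\<in>Basis. e \<bullet> (H ^^ p) e) - (\<Sum>e\<in>Basis. e \<bullet> (N ^^ p) e)) \<le>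
        r * (\<Sum>j<p. \<Sum>u\<in>?B. ?w u * (?l u ^ (p - Suc j) * (?l u + r) ^ j))"
      using r by (intro mult_left_mono) auto
    also have "\<dots> = (\<Sum>u\<in>?B. ?w u * (r * (\<Sum>j<p. ?l u ^ (p - Suc j) * (?l u + r) ^ j)))"
      by (subst sum.swap) (simp add: sum_distrib_left mult_ac)
    also have "\<dots> = (\<Sum>u\<in>?B. ?w u * ((?l u + r) ^ p - ?l u ^ p))"
      by (intro sum.cong refl) (simp add: power_diff_sumr2)
    finally show ?thesis .
  qed
  have "(\<lambda>p. r * ((\<Sum>e\<in>Basis. e \<bullet> (H ^^ p) e) /\<^sub>R fact p - (\<Sum>e\<in>Basis. e \<bullet> (N ^^ p) e) /\<^sub>R fact p))
      sums (r * (trace_exp H - trace_exp N))"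
    by (intro sums_mult sums_diff trace_exp_sums symN H(1))
  moreover have "(\<lambda>p. \<Sum>u\<in>?B. ?w u * ((?l u + r) ^ p /\<^sub>R fact p - ?l u ^ p /\<^sub>R fact p))
      sums (\<Sum>u\<in>?B. ?w u * (exp (?l u + r) - exp (?l u)))"
    by (intro sums_sum sums_mult sums_diff exp_converges)
  ultimately have "r * (trace_exp H - trace_exp N) \<le> (\<Sum>u\<in>?B. ?w u * (exp (?l u + r) - exp (?l u)))"
  proof (rule sums_le[rotated])
    fix p
    have "r * ((\<Sum>e\<in>Basis. e \<bullet> (H ^^ p) e) /\<^sub>R fact p - (\<Sum>e\<in>Basis. e \<bullet> (N ^^ p) e) /\<^sub>R fact p) =
        (r * ((\<Sum>e\<in>Basis. e \<bullet> (H ^^ p) e) - (\<Sum>e\<in>Basis. e \<bullet> (N ^^ p) e))) /\<^sub>R fact p"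
      by (simp add: algebra_simps)
    also have "\<dots> \<le> (\<Sum>u\<in>?B. ?w u * ((?l u + r) ^ p - ?l u ^ p)) /\<^sub>R fact p"
      by (intro scaleR_left_mono le) simp
    also have "\<dots> = (\<Sum>u\<in>?B. ?w u * ((?l u + r) ^ p /\<^sub>R fact p - ?l u ^ p /\<^sub>R fact p))"
      by (simp add: sum_distrib_left algebra_simps)
    finally show "r * ((\<Sum>e\<in>Basis. e \<bullet> (H ^^ p) e) /\<^sub>R fact p - (\<Sum>e\<in>Basis. e \<bullet> (N ^^ p) e) /\<^sub>R fact p)
      \<le> (\<Sum>u\<in>?B. ?w u * ((?l u + r) ^ p /\<^sub>R fact p - ?l u ^ p /\<^sub>R fact p))" .
  qed
  also have "\<dots> = (exp r - 1) * exp_form N a"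
    unfolding exp_form_def sum_distrib_left
    by (intro sum.cong refl) (simp add: exp_add algebra_simps)
  finally show ?thesis using r by (simp add: field_simps)
qed

text \<open>Monotonicity of the exponential under the trace: \<open>tr ((X - Y) (exp X - exp Y)) \<ge> 0\<close>.\<close>

lemma exp_form_swap:
  assumes X: "symmetric_op X" and Y: "symmetric_op Y"
    and XY: "\<And>x. X x - Y x = (a \<bullet> x) *\<^sub>R a - (c \<bullet> x) *\<^sub>R c"
  shows "exp_form X c + exp_form Y a \<le> exp_form X a + exp_form Y c"
proof -
  let ?B = "some_eigenbasis X" and ?C = "some_eigenbasis Y"
  let ?l = "\<lambda>u. X u \<bullet> u" and ?m = "\<lambda>v. Y v \<bullet> v"
  note B = eigenbasis_some_eigenbasis[OF X] and C = eigenbasis_some_eigenbasis[OF Y]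
  have lin: "linear X" "linear Y" using X Y by (auto simp: symmetric_op_def)
  have XY': "(a \<bullet> x)\<^sup>2 - (c \<bullet> x)\<^sup>2 = X x \<bullet> x - Y x \<bullet> x" for x
  proof -
    have "(X x - Y x) \<bullet> x = (a \<bullet> x)\<^sup>2 - (c \<bullet> x)\<^sup>2"
      unfolding XY by (simp add: inner_diff_left power2_eq_square)
    then show ?thesis by (simp add: inner_diff_left)
  qed
  have nB: "u \<bullet> u = 1" if "u \<in> ?B" for u using B that by (auto simp: eigenbasis_def norm_eq_1)
  have nC: "u \<bullet> u = 1" if "u \<in> ?C" for u using C that by (auto simp: eigenbasis_def norm_eq_1)
  \<comment> \<open>The squared overlaps \<open>(u \<bullet> v)\<^sup>2\<close> of the two
    orthonormal bases sum to 1 over either index, so the form of \<open>X - Y\<close> spreads over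
    pairs of eigenvectors.\<close>
  have 1: "(a \<bullet> u)\<^sup>2 - (c \<bullet> u)\<^sup>2 = (\<Sum>v\<in>?C. (?l u - ?m v) * (u \<bullet> v)\<^sup>2)" if "u \<in> ?B" for u
  proof -
    have "Y u \<bullet> u = (\<Sum>v\<in>?C. (u \<bullet> v)\<^sup>2 * ?m v)"
      using eigenbasis_funpow[OF C lin(2), of u 1 u] by (simp add: power2_eq_square inner_commute)
    moreover have "(\<Sum>v\<in>?C. (u \<bullet> v)\<^sup>2) = 1"
      using eigenbasis_inner[OF C, of u u] nB[OF that] by (simp add: power2_eq_square)
    ultimately show ?thesis
      unfolding XY' by (simp add: left_diff_distrib sum_subtractf mult.commute[of "_\<^sup>2"]
          sum_distrib_left[of "?l u", symmetric])
  qed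
  have 2: "(a \<bullet> v)\<^sup>2 - (c \<bullet> v)\<^sup>2 = (\<Sum>u\<in>?B. (?l u - ?m v) * (u \<bullet> v)\<^sup>2)" if "v \<in> ?C" for v
  proof -
    have "X v \<bullet> v = (\<Sum>u\<in>?B. (u \<bullet> v)\<^sup>2 * ?l u)"
      using eigenbasis_funpow[OF B lin(1), of v 1 v] by (simp add: power2_eq_square inner_commute)
    moreover have "(\<Sum>u\<in>?B. (u \<bullet> v)\<^sup>2) = 1"
      using eigenbasis_inner[OF B, of v v] nC[OF that] by (simp add: power2_eq_square inner_commute)
    ultimately show ?thesis
      unfolding XY' by (simp add: left_diff_distrib sum_subtractf mult.commute[of "_\<^sup>2"]
          sum_distrib_left[of "?m v", symmetric])
  qed
  have "exp_form X a - exp_form X c = (\<Sum>u\<in>?B. exp (?l u) * ((a \<bullet> u)\<^sup>2 - (c \<bullet> u)\<^sup>2))"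
    by (simp add: exp_form_def algebra_simps sum_subtractf)
  also have "\<dots> = (\<Sum>u\<in>?B. \<Sum>v\<in>?C. exp (?l u) * ((?l u - ?m v) * (u \<bullet> v)\<^sup>2))"
    by (intro sum.cong refl) (simp add: 1 sum_distrib_left)
  finally have X': "exp_form X a - exp_form X c = \<dots>" .
  have "exp_form Y a - exp_form Y c = (\<Sum>v\<in>?C. exp (?m v) * ((a \<bullet> v)\<^sup>2 - (c \<bullet> v)\<^sup>2))"
    by (simp add: exp_form_def algebra_simps sum_subtractf)
  also have "\<dots> = (\<Sum>v\<in>?C. \<Sum>u\<in>?B. exp (?m v) * ((?l u - ?m v) * (u \<bullet> v)\<^sup>2))"
    by (intro sum.cong refl) (simp add: 2 sum_distrib_left)
  also have "\<dots> = (\<Sum>u\<in>?B. \<Sum>v\<in>?C. exp (?m v) * ((?l u - ?m v) * (u \<bullet> v)\<^sup>2))" by (rule sum.swap)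
  finally have Y': "exp_form Y a - exp_form Y c = \<dots>" .
  \<comment> \<open>This is the trace of \<open>(X - Y) (exp X - exp Y)\<close> written over pairs
    of eigenvectors; each summand is nonnegative because \<open>exp\<close> is increasing.\<close>
  have "0 \<le> (\<Sum>u\<in>?B. \<Sum>v\<in>?C. (exp (?l u) - exp (?m v)) * (?l u - ?m v) * (u \<bullet> v)\<^sup>2)"
  proof (intro sum_nonneg mult_nonneg_nonneg[of "_ * _" "_\<^sup>2"])
    fix u v
    have "0 \<le> (exp s - exp t) * (s - t)" for s t :: real
      by (cases "s \<le> t") (simp_all add: mult_nonpos_nonpos)
    then show "0 \<le> (exp (?l u) - exp (?m v)) * (?l u - ?m v)" .
  qed simp
  also have "\<dots> = (exp_form X a - exp_form X c) - (exp_form Y a - exp_form Y c)"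
    unfolding X' Y' sum_subtractf[symmetric] by (intro sum.cong refl) (simp add: algebra_simps)
  finally show ?thesis by simp
qed

text \<open>In an eigenbasis of \<open>N\<close> the weights
  \<open>(v i \<bullet> u)\<^sup>2\<close> of each \<open>exp (N u \<bullet> u)\<close> add up over
  \<open>i\<close> to at most \<open>L\<close>.\<close>

lemma sum_exp_form_le:
  assumes "symmetric_op N" and L: "\<And>x. (\<Sum>i\<in>I. (v i \<bullet> x)\<^sup>2) \<le> L * (x \<bullet> x)"
  shows "(\<Sum>i\<in>I. exp_form N (v i)) \<le> L * trace_exp N"
proof -
  note B = eigenbasis_some_eigenbasis[OF assms(1)]
  have "(\<Sum>i\<in>I. exp_form N (v i)) = (\<Sum>u\<in>some_eigenbasis N. (\<Sum>i\<in>I. (v i \<bullet> u)\<^sup>2) * exp (N u \<bullet> u))"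
    unfolding exp_form_def by (subst sum.swap) (simp add: sum_distrib_right)
  also have "\<dots> \<le> (\<Sum>u\<in>some_eigenbasis N. (L * (u \<bullet> u)) * exp (N u \<bullet> u))"
    by (intro sum_mono mult_right_mono L) simp
  also have "\<dots> = L * trace_exp N"
    unfolding trace_exp_def sum_distrib_left
    using B by (intro sum.cong refl) (auto simp: eigenbasis_def norm_eq_1)
  finally show ?thesis .
qed

text \<open>Each \<open>exp (f u \<bullet> u)\<close> is one summand of a sum of positive terms, so
  every eigenvalue is at most the logarithm of the trace exponential.\<close>

lemma inner_le_ln_trace_exp:
  assumes "symmetric_op f"
  shows "f x \<bullet> x \<le> ln (trace_exp f) * (x \<bullet> x)"
proof -
  let ?B = "some_eigenbasis f"
  note B = eigenbasis_some_eigenbasis[OF assms]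
  have lin: "linear f" using assms by (simp add: symmetric_op_def)
  have "f x \<bullet> x = (\<Sum>u\<in>?B. (f u \<bullet> u) * (x \<bullet> u)\<^sup>2)"
    using eigenbasis_funpow[OF B lin, of x 1 x] by (simp add: power2_eq_square inner_commute mult_ac)
  also have "\<dots> \<le> (\<Sum>u\<in>?B. ln (trace_exp f) * (x \<bullet> u)\<^sup>2)"
  proof (intro sum_mono mult_right_mono)
    fix u assume u: "u \<in> ?B"
    have "exp (f u \<bullet> u) \<le> trace_exp f"
      unfolding trace_exp_def using B u by (intro member_le_sum) (auto simp: eigenbasis_def)
    then have "ln (exp (f u \<bullet> u)) \<le> ln (trace_exp f)"
      by (subst ln_le_cancel_iff) (auto intro: less_le_trans[OF exp_gt_zero])
    then show "f u \<bullet> u \<le> ln (trace_exp f)" by simp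
  qed simp
  also have "\<dots> = ln (trace_exp f) * (x \<bullet> x)"
    by (simp add: eigenbasis_inner[OF B, of x x] power2_eq_square sum_distrib_left)
  finally show ?thesis .
qed

lemma trace_exp_zero: "trace_exp (\<lambda>_::'a::euclidean_space. 0) = DIM('a)"
proof -
  have "symmetric_op (\<lambda>_::'a. 0)" by (auto simp: symmetric_op_def linear_zero)
  then show ?thesis by (simp add: trace_exp_def card_eigenbasis[OF eigenbasis_some_eigenbasis])
qed

subsection \<open>Sampling without replacement\<close>

definition gram_op :: "('i \<Rightarrow> 'a::euclidean_space) \<Rightarrow> 'i set \<Rightarrow> 'a \<Rightarrow> 'a" where
  "gram_op v T x = (\<Sum>i\<in>T. (v i \<bullet> x) *\<^sub>R v i)"

lemma inner_gram_op: "gram_op v T x \<bullet> y = (\<Sum>i\<in>T. (v i \<bullet> x) * (v i \<bullet> y))"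
  by (simp add: gram_op_def inner_sum_left)

lemma symmetric_op_gram_op: "symmetric_op (gram_op v T)"
  unfolding symmetric_op_def
proof (intro conjI allI)
  show "linear (gram_op v T)"
    by (rule linearI) (simp_all add: gram_op_def inner_add_right scaleR_add_left sum.distrib scaleR_sum_right)
  show "gram_op v T x \<bullet> y = x \<bullet> gram_op v T y" for x y
    unfolding inner_gram_op inner_commute[of x] by (simp add: mult.commute)
qed

lemma psd_op_gram_op: "psd_op (gram_op v T)"
  by (auto simp: psd_op_def symmetric_op_gram_op inner_gram_op intro!: sum_nonneg)

lemma gram_op_insert:
  "finite T \<Longrightarrow> i \<notin> T \<Longrightarrow> gram_op v (insert i T) x = gram_op v T x + (v i \<bullet> x) *\<^sub>R v i"
  by (simp add: gram_op_def)

text \<open>Double counting: a set with a marked element corresponds to a set one smaller with a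
  marked element outside it.\<close>

lemma sum_card_Suc_subsets:
  fixes h :: "'i::finite set \<Rightarrow> 'i \<Rightarrow> 'b::comm_monoid_add"
  shows "(\<Sum>S | card S = Suc t. \<Sum>i\<in>S. h (S - {i}) i) = (\<Sum>T | card T = t. \<Sum>i\<in>-T. h T i)"
  unfolding sum.Sigma[OF finite ballI[OF finite]]
  by (rule sum.reindex_bij_witness[where i = "\<lambda>(T, i). (insert i T, i)" and j = "\<lambda>(S, i). (S - {i}, i)"])
    (auto simp: insert_absorb)

text \<open>Exchanging a chosen index \<open>i\<close> with an unchosen \<open>k\<close> pairs up the terms, and each pair is
  handled by \<open>exp_form_swap\<close>. This replaces independence in sampling without replacement.\<close>

lemma sum_exp_form_outside_le:
  fixes v :: "'i::finite \<Rightarrow> 'a::euclidean_space"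
  defines "g \<equiv> \<lambda>i T. exp_form (gram_op v T) (v i)"
  shows "real t * (\<Sum>T | card T = t. \<Sum>i\<in>-T. g i T) \<le>
      (real CARD('i) - real t) * (\<Sum>T | card T = t. \<Sum>i\<in>T. g i T)"
proof -
  define P :: "('i set \<times> 'i \<times> 'i) set" where "P = (SIGMA T:{T. card T = t}. T \<times> -T)"
  \<comment> \<open>The exchange of \<open>i\<close> and \<open>k\<close> is an involution of
    \<open>P\<close>, so twice the sum of \<open>?d\<close> equals the sum of its
    symmetrisation.\<close>
  let ?s = "\<lambda>(T, i, k). (insert k (T - {i}), k, i)"
  let ?d = "\<lambda>(T, i, k). g i T - g k T"
  have inv: "?s p \<in> P" "?s (?s p) = p" if "p \<in> P" for p
  proof -
    from that obtain T i k where p: "p = (T, i, k)" "card T = t" "i \<in> T" "k \<notin> T" by (auto simp: P_def)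
    then have "Suc (card (T - {i})) = t" by (metis card_Suc_Diff1 finite)
    then show "?s p \<in> P" "?s (?s p) = p" using p by (auto simp: P_def)
  qed
  have "(\<Sum>p\<in>P. ?d p) = (\<Sum>p\<in>P. ?d (?s p))"
    by (rule sum.reindex_bij_witness[where i = ?s and j = ?s]) (use inv in auto)
  then have "2 * (\<Sum>p\<in>P. ?d p) = (\<Sum>p\<in>P. ?d p + ?d (?s p))"
    by (simp add: sum.distrib)
  also have "\<dots> \<ge> 0"
  proof (rule sum_nonneg)
    fix p assume "p \<in> P"
    then obtain T i k where p: "p = (T, i, k)" "i \<in> T" "k \<notin> T" by (auto simp: P_def)
    define U where "U = T - {i}"
    have T: "T = insert i U" "i \<notin> U" "k \<notin> U" using p by (auto simp: U_def)
    have "exp_form (gram_op v (insert i U)) (v k) + exp_form (gram_op v (insert k U)) (v i)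
        \<le> exp_form (gram_op v (insert i U)) (v i) + exp_form (gram_op v (insert k U)) (v k)"
      by (intro exp_form_swap symmetric_op_gram_op) (simp add: gram_op_insert T)
    then show "0 \<le> ?d p + ?d (?s p)" using T by (simp add: p g_def)
  qed
  finally have "0 \<le> (\<Sum>p\<in>P. ?d p)" by simp
  also have "(\<Sum>p\<in>P. ?d p) = (\<Sum>T | card T = t. \<Sum>i\<in>T. \<Sum>k\<in>-T. g i T - g k T)"
    unfolding P_def by (simp add: sum.Sigma sum.cartesian_product)
  also have "\<dots> = (\<Sum>T | card T = t. (real CARD('i) - real t) * (\<Sum>i\<in>T. g i T) - real t * (\<Sum>k\<in>-T. g k T))"
  proof (intro sum.cong refl)
    fix T :: "'i set" assume "T \<in> {T. card T = t}"
    then have T: "card T = t" "card (-T) = CARD('i) - t" "t \<le> CARD('i)"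
      by (auto simp: Compl_eq_Diff_UNIV card_Diff_subset intro: card_mono)
    show "(\<Sum>i\<in>T. \<Sum>k\<in>-T. g i T - g k T) =
        (real CARD('i) - real t) * (\<Sum>i\<in>T. g i T) - real t * (\<Sum>k\<in>-T. g k T)"
      using T by (simp add: sum_subtractf of_nat_diff sum_distrib_left)
  qed
  finally show ?thesis by (simp add: sum_subtractf sum_distrib_left)
qed

text \<open>One sampling step. After normalising by the numbers of sets, the mean trace exponential
  grows at most by the factor \<open>1 + (exp r - 1) / r * (L / n)\<close>, where \<open>n\<close>
  is the number of vectors.\<close>

lemma sum_trace_exp_Suc_le:
  fixes v :: "'i::finite \<Rightarrow> 'a::euclidean_space"
  assumes r: "\<And>i. v i \<bullet> v i \<le> r" "0 < r"
    and L: "\<And>x. (\<Sum>i\<in>UNIV. (v i \<bullet> x)\<^sup>2) \<le> L * (x \<bullet> x)"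
    and t: "t < CARD('i)"
  shows "real (Suc t) * (\<Sum>S | card S = Suc t. trace_exp (gram_op v S)) \<le>
     (real CARD('i) - real t) * (1 + (exp r - 1) / r * (L / real CARD('i))) *
       (\<Sum>T | card T = t. trace_exp (gram_op v T))"
proof -
  let ?n = "real CARD('i)" and ?F = "\<Sum>T | card T = t. trace_exp (gram_op v T)" and ?c = "(exp r - 1) / r"
  let ?O = "\<Sum>T | card T = t. \<Sum>i\<in>-T. exp_form (gram_op v T) (v i)"
  let ?I = "\<Sum>T | card T = t. \<Sum>i\<in>T. exp_form (gram_op v T) (v i)"
  have n: "?n > 0" "?n - real t \<ge> 0" using t by auto
  have c: "?c \<ge> 0" using r by simp
  have "?I + ?O = (\<Sum>T | card T = t. \<Sum>i\<in>UNIV. exp_form (gram_op v T) (v i))"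
    unfolding sum.distrib[symmetric]
    by (intro sum.cong refl) (subst sum.union_disjoint[symmetric], auto simp: Compl_partition)
  also have "\<dots> \<le> L * ?F"
    unfolding sum_distrib_left by (intro sum_mono sum_exp_form_le symmetric_op_gram_op L)
  finally have IO: "?I + ?O \<le> L * ?F" .
  \<comment> \<open>The exchange inequality \<open>t * ?O \<le> (n - t) * ?I\<close> bounds the
    average over unchosen indices by the average over chosen ones, hence by the average over all
    indices.\<close>
  have "?n * ?O = real t * ?O + (?n - real t) * ?O" by (simp add: algebra_simps)
  also have "\<dots> \<le> (?n - real t) * ?I + (?n - real t) * ?O"
    using sum_exp_form_outside_le[of t v] by simp
  also have "\<dots> = (?n - real t) * (?I + ?O)" by (simp add: algebra_simps)
  also have "\<dots> \<le> (?n - real t) * (L * ?F)" using n IO by (intro mult_left_mono)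
  finally have O: "?O \<le> (?n - real t) * (L / ?n * ?F)"
    using n by (simp add: field_simps)
  have "real (Suc t) * (\<Sum>S | card S = Suc t. trace_exp (gram_op v S)) =
      (\<Sum>S | card S = Suc t. \<Sum>i\<in>S. trace_exp (gram_op v (insert i (S - {i}))))"
    unfolding sum_distrib_left by (intro sum.cong refl) (auto simp: insert_absorb cong: sum.cong)
  also have "\<dots> = (\<Sum>T | card T = t. \<Sum>i\<in>-T. trace_exp (gram_op v (insert i T)))"
    by (rule sum_card_Suc_subsets)
  also have "\<dots> \<le> (\<Sum>T | card T = t. \<Sum>i\<in>-T. trace_exp (gram_op v T) + ?c * exp_form (gram_op v T) (v i))"
    by (intro sum_mono trace_exp_rank_one_update psd_op_gram_op symmetric_op_gram_op r)
      (simp add: gram_op_insert)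
  also have "\<dots> = (\<Sum>T | card T = t. \<Sum>i\<in>-T. trace_exp (gram_op v T)) + ?c * ?O"
    by (simp only: sum.distrib sum_distrib_left)
  also have "(\<Sum>T | card T = t. \<Sum>i\<in>-T. trace_exp (gram_op v T)) = (?n - real t) * ?F"
    unfolding sum_distrib_left using t
    by (intro sum.cong refl) (auto simp: Compl_eq_Diff_UNIV card_Diff_subset of_nat_diff)
  also have "(?n - real t) * ?F + ?c * ?O \<le> (?n - real t) * ?F + ?c * ((?n - real t) * (L / ?n * ?F))"
    by (intro add_left_mono mult_left_mono O c)
  also have "\<dots> = (?n - real t) * (1 + ?c * (L / ?n)) * ?F"
    by (simp only: distrib_left distrib_right mult_1_left mult_1_right mult_ac)
  finally show ?thesis .
qed

lemma binomial_Suc_mult: "Suc t * (n choose Suc t) = (n - t) * (n choose t)"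
  by (metis binomial_absorb_comp binomial_absorption mult.commute)

text \<open>Iterates the sampling step from the empty set, where the trace exponential is the trace
  of the identity and contributes the factor \<open>DIM('a)\<close>.\<close>

lemma sum_trace_exp_le:
  fixes v :: "'i::finite \<Rightarrow> 'a::euclidean_space"
  assumes r: "\<And>i. v i \<bullet> v i \<le> r" "0 < r"
    and L: "\<And>x. (\<Sum>i\<in>UNIV. (v i \<bullet> x)\<^sup>2) \<le> L * (x \<bullet> x)" "0 \<le> L"
    and t: "t \<le> CARD('i)"
  shows "(\<Sum>S | card S = t. trace_exp (gram_op v S)) \<le>
     real (CARD('i) choose t) * real DIM('a) * (1 + (exp r - 1) / r * (L / real CARD('i))) ^ t"
  using t
proof (induction t)
  case 0
  have "{S::'i set. card S = 0} = {{}}" by auto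
  moreover have "gram_op v {} = (\<lambda>_. 0)" by (simp add: gram_op_def fun_eq_iff)
  ultimately show ?case by (simp add: trace_exp_zero)
next
  case (Suc t)
  let ?n = "CARD('i)" and ?q = "1 + (exp r - 1) / r * (L / real CARD('i))"
  have q: "0 \<le> ?q" using r L(2) by (intro add_nonneg_nonneg mult_nonneg_nonneg divide_nonneg_nonneg) auto
  have "real (Suc t) * (\<Sum>S | card S = Suc t. trace_exp (gram_op v S)) \<le>
      (real ?n - real t) * ?q * (\<Sum>T | card T = t. trace_exp (gram_op v T))"
    using Suc.prems by (intro sum_trace_exp_Suc_le r L) auto
  also have "\<dots> \<le> (real ?n - real t) * ?q * (real (?n choose t) * real DIM('a) * ?q ^ t)"
    using q Suc.prems by (intro mult_left_mono Suc.IH mult_nonneg_nonneg) auto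
  also have "\<dots> = (real (?n - t) * real (?n choose t)) * real DIM('a) * ?q ^ Suc t"
    using Suc.prems by (simp add: of_nat_diff)
  also have "real (?n - t) * real (?n choose t) = real (Suc t) * real (?n choose Suc t)"
    by (metis binomial_Suc_mult of_nat_mult)
  finally have "real (Suc t) * (\<Sum>S | card S = Suc t. trace_exp (gram_op v S)) \<le>
      real (Suc t) * (real (?n choose Suc t) * real DIM('a) * ?q ^ Suc t)"
    by (simp only: mult.assoc)
  then show ?case by (rule mult_left_le_imp_le) simp
qed

subsection \<open>Tail bound for random row submatrices\<close>

lemma trace_exp_pos:
  fixes f :: "'a::euclidean_space \<Rightarrow> 'a"
  assumes "symmetric_op f"
  shows "0 < trace_exp f"
proof -
  note B = eigenbasis_some_eigenbasis[OF assms]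
  have "card (some_eigenbasis f) \<noteq> 0" by (simp add: card_eigenbasis[OF B])
  then show ?thesis unfolding trace_exp_def by (intro sum_pos) (auto intro: ccontr)
qed

text \<open>Markov's inequality in counting form: every bad set contributes at least
  \<open>exp (\<theta> * u)\<close> to the sum of trace exponentials. Scaling the vectors by
  \<open>sqrt \<theta>\<close> multiplies their Gram operator by \<theta>, and
  \<open>1 + x \<le> exp x\<close> brings the bound into exponential form.\<close>

lemma card_large_gram_le:
  fixes v :: "'i::finite \<Rightarrow> 'a::euclidean_space"
  assumes R: "\<And>i. v i \<bullet> v i \<le> R" "0 < R"
    and L: "\<And>x. (\<Sum>i\<in>UNIV. (v i \<bullet> x)\<^sup>2) \<le> L * (x \<bullet> x)" "0 \<le> L"
    and t: "t \<le> CARD('i)" and \<theta>: "0 < \<theta>"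
  shows "real (card {S. card S = t \<and> (\<exists>x. u * (x \<bullet> x) < (\<Sum>i\<in>S. (v i \<bullet> x)\<^sup>2))}) * exp (\<theta> * u) \<le>
     real (CARD('i) choose t) * real DIM('a) * exp (t * (L / CARD('i)) * ((exp (\<theta> * R) - 1) / R))"
proof -
  define w where "w i = sqrt \<theta> *\<^sub>R v i" for i
  let ?Bad = "{S. card S = t \<and> (\<exists>x. u * (x \<bullet> x) < (\<Sum>i\<in>S. (v i \<bullet> x)\<^sup>2))}"
  have wv: "(w i \<bullet> x)\<^sup>2 = \<theta> * (v i \<bullet> x)\<^sup>2" for i x
    using \<theta> by (simp add: w_def power_mult_distrib)
  have large: "exp (\<theta> * u) \<le> trace_exp (gram_op w S)" if S: "S \<in> ?Bad" for S
  proof (rule ccontr)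
    assume "\<not> exp (\<theta> * u) \<le> trace_exp (gram_op w S)"
    then have "ln (trace_exp (gram_op w S)) \<le> ln (exp (\<theta> * u))"
      using trace_exp_pos[OF symmetric_op_gram_op, of w S] by (subst ln_le_cancel_iff) auto
    then have ln: "ln (trace_exp (gram_op w S)) \<le> \<theta> * u" by simp
    obtain x where x: "u * (x \<bullet> x) < (\<Sum>i\<in>S. (v i \<bullet> x)\<^sup>2)" using S by blast
    have "\<theta> * (\<Sum>i\<in>S. (v i \<bullet> x)\<^sup>2) = gram_op w S x \<bullet> x"
      unfolding inner_gram_op by (simp add: sum_distrib_left wv power2_eq_square[symmetric])
    also have "\<dots> \<le> ln (trace_exp (gram_op w S)) * (x \<bullet> x)"
      by (intro inner_le_ln_trace_exp symmetric_op_gram_op)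
    also have "\<dots> \<le> \<theta> * u * (x \<bullet> x)" by (intro mult_right_mono ln) simp
    finally show False using x \<theta> by (simp add: mult.assoc)
  qed
  have "real (card ?Bad) * exp (\<theta> * u) = (\<Sum>S\<in>?Bad. exp (\<theta> * u))" by simp
  also have "\<dots> \<le> (\<Sum>S\<in>?Bad. trace_exp (gram_op w S))" by (intro sum_mono large)
  also have "\<dots> \<le> (\<Sum>S | card S = t. trace_exp (gram_op w S))"
    by (intro sum_mono2) (auto intro: less_imp_le trace_exp_pos symmetric_op_gram_op)
  also have "\<dots> \<le> real (CARD('i) choose t) * real DIM('a) *
      (1 + (exp (\<theta> * R) - 1) / (\<theta> * R) * (\<theta> * L / real CARD('i))) ^ t"
  proof (rule sum_trace_exp_le)
    show "w i \<bullet> w i \<le> \<theta> * R" for i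
      using R(1)[of i] \<theta> by (simp add: w_def mult.assoc[symmetric])
    show "(\<Sum>i\<in>UNIV. (w i \<bullet> x)\<^sup>2) \<le> \<theta> * L * (x \<bullet> x)" for x
      using L(1)[of x] \<theta> by (simp add: wv sum_distrib_left[symmetric] mult.assoc)
  qed (use R L t \<theta> in auto)
  also have "\<dots> \<le> real (CARD('i) choose t) * real DIM('a) *
      exp ((exp (\<theta> * R) - 1) / (\<theta> * R) * (\<theta> * L / real CARD('i))) ^ t"
    using R L \<theta> by (intro mult_left_mono power_mono exp_ge_add_one_self add_nonneg_nonneg
        mult_nonneg_nonneg divide_nonneg_nonneg) auto
  also have "exp ((exp (\<theta> * R) - 1) / (\<theta> * R) * (\<theta> * L / real CARD('i))) ^ t =
      exp (t * (L / CARD('i)) * ((exp (\<theta> * R) - 1) / R))"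
  proof -
    have "(exp (\<theta> * R) - 1) / (\<theta> * R) * (\<theta> * L / real CARD('i)) = L / CARD('i) * ((exp (\<theta> * R) - 1) / R)"
      using \<theta> by (simp add: mult_ac)
    then show ?thesis by (simp add: exp_of_nat_mult[symmetric] mult.assoc)
  qed
  finally show ?thesis .
qed

text \<open>The optimal \<theta> makes the right-hand exponent equal to \<delta> and the left-hand
  factor at least \<open>y powr \<delta>\<close> with \<open>y = 1 + \<delta> * R / \<mu>\<close>.
  The hypothesis \<open>\<mu> \<le> R\<close> gives \<open>y \<ge> \<delta>\<close>.\<close>

lemma card_large_gram_powr_le:
  fixes v :: "'i::finite \<Rightarrow> 'a::euclidean_space"
  assumes R: "\<And>i. v i \<bullet> v i \<le> R" "0 < R"
    and L: "\<And>x. (\<Sum>i\<in>UNIV. (v i \<bullet> x)\<^sup>2) \<le> L * (x \<bullet> x)" "0 < L"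
    and t: "0 < t" "t \<le> CARD('i)" and \<mu>: "\<mu> = t * (L / CARD('i))" "\<mu> \<le> R" and \<delta>: "0 < \<delta>"
  shows "real (card {S. card S = t \<and> (\<exists>x. (\<mu> + \<delta> * R) * (x \<bullet> x) < (\<Sum>i\<in>S. (v i \<bullet> x)\<^sup>2))}) \<le>
     real (CARD('i) choose t) * real DIM('a) * (exp 1 / \<delta>) powr \<delta>"
proof -
  let ?c = "real (card {S. card S = t \<and> (\<exists>x. (\<mu> + \<delta> * R) * (x \<bullet> x) < (\<Sum>i\<in>S. (v i \<bullet> x)\<^sup>2))})"
  have \<mu>0: "0 < \<mu>" using L(2) t by (simp add: \<mu>(1))
  define y where "y = 1 + \<delta> * R / \<mu>"
  have y: "1 < y" using \<mu>0 \<delta> R(2) by (simp add: y_def)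
  have "\<delta> \<le> \<delta> * R / \<mu>" using \<mu> \<mu>0 \<delta> by (simp add: field_simps)
  then have y\<delta>: "\<delta> \<le> y" by (simp add: y_def)
  define \<theta> where "\<theta> = ln y / R" \<comment> \<open>the minimiser of the exponential bound\<close>
  have \<theta>: "0 < \<theta>" and e: "exp (\<theta> * R) = y" using y R(2) by (auto simp: \<theta>_def)
  have "?c * exp (\<theta> * (\<mu> + \<delta> * R)) \<le>
      real (CARD('i) choose t) * real DIM('a) * exp (t * (L / CARD('i)) * ((exp (\<theta> * R) - 1) / R))"
    using R L t \<theta> by (intro card_large_gram_le) auto
  also have "t * (L / CARD('i)) * ((exp (\<theta> * R) - 1) / R) = \<delta>"
    unfolding e using \<mu>(1)[symmetric] \<mu>0 R(2) by (simp add: y_def)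
  finally have *: "?c * exp (\<theta> * (\<mu> + \<delta> * R)) \<le> real (CARD('i) choose t) * real DIM('a) * exp \<delta>" .
  have "\<delta> powr \<delta> \<le> y powr \<delta>" using y\<delta> \<delta> by (intro powr_mono2) auto
  also have "\<dots> = exp (\<theta> * (\<delta> * R))" using y R(2) by (simp add: powr_def \<theta>_def)
  also have "\<dots> \<le> exp (\<theta> * (\<mu> + \<delta> * R))" using \<theta> \<mu>0 by simp
  finally have "?c * \<delta> powr \<delta> \<le> ?c * exp (\<theta> * (\<mu> + \<delta> * R))" by (intro mult_left_mono) auto
  also note *
  finally show ?thesis
    using \<delta> by (simp add: powr_divide field_simps) (simp add: powr_def mult_ac)
qed

section \<open>Row submatrices and their spectral norms\<close>

lemma matrix_vector_nth_row: "((A::real^'d^'n) *v x) $ i = row i A \<bullet> x"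
  by (simp add: matrix_vector_mult_def row_def inner_vec_def)

lemma nonzero_row:
  assumes "(A::real^'d^'n) \<noteq> 0"
  obtains i where "row i A \<noteq> 0"
  using assms by (metis matrix_eq matrix_vector_mult_0 matrix_vector_nth_row inner_zero_left vec_eq_iff zero_index)

lemma norm_subsample_mult:
  "(norm (subsample S (A::real^'d^'n) *v x))\<^sup>2 = (\<Sum>i\<in>S. (row i A \<bullet> x)\<^sup>2)"
proof -
  have "(norm (subsample S A *v x))\<^sup>2 = (\<Sum>i\<in>UNIV. if i \<in> S then (row i A \<bullet> x)\<^sup>2 else 0)"
    unfolding power2_norm_eq_inner inner_vec_def
    by (intro sum.cong refl) (auto simp: matrix_vector_nth_row row_def subsample_def power2_eq_square inner_vec_def)
  then show ?thesis by (simp add: sum.If_cases)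
qed

lemma norm_mult_rows: "(norm ((A::real^'d^'n) *v x))\<^sup>2 = (\<Sum>i\<in>UNIV. (row i A \<bullet> x)\<^sup>2)"
  using norm_subsample_mult[of UNIV A x] by (simp add: subsample_def)

lemma spectral_norm_sq_leI:
  fixes A :: "real^'d^'n"
  assumes "\<And>x. (norm (A *v x))\<^sup>2 \<le> c * (x \<bullet> x)" "0 \<le> c"
  shows "(spectral_norm A)\<^sup>2 \<le> c"
proof -
  have "spectral_norm A \<le> sqrt c"
  proof (rule spectral_norm_leI)
    fix x
    have "(norm (A *v x))\<^sup>2 \<le> (sqrt c * norm x)\<^sup>2"
      using assms by (simp add: power_mult_distrib power2_norm_eq_inner)
    then show "norm (A *v x) \<le> sqrt c * norm x"
      by (rule power2_le_imp_le) (simp add: assms)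
  qed
  then have "(spectral_norm A)\<^sup>2 \<le> (sqrt c)\<^sup>2" by (intro power_mono spectral_norm_nonneg)
  with assms show ?thesis by simp
qed

lemma norm_mult_sq_le: "(norm ((A::real^'d^'n) *v x))\<^sup>2 \<le> (spectral_norm A)\<^sup>2 * (x \<bullet> x)"
  using power_mono[OF norm_matrix_le[of A x], of 2] by (simp add: power_mult_distrib power2_norm_eq_inner)

lemma spectral_norm_pos: "A \<noteq> 0 \<Longrightarrow> 0 < spectral_norm (A::real^'d^'n)"
  using norm_matrix_le[of A] spectral_norm_nonneg[of A]
  by (metis matrix_eq matrix_vector_mult_0 mult_zero_left norm_le_zero_iff order_le_less)

lemma norm_row_sq_le: "(norm (row i A))\<^sup>2 \<le> norm_1_2_transpose_sq (A::real^'d^'n)"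
  unfolding norm_1_2_transpose_sq_def by (intro Max_ge) auto

lemma norm_1_2_transpose_sq_pos:
  assumes "(A::real^'d^'n) \<noteq> 0"
  shows "0 < norm_1_2_transpose_sq A"
proof -
  obtain i where "row i A \<noteq> 0" using nonzero_row[OF assms] .
  then show ?thesis by (intro less_le_trans[OF _ norm_row_sq_le[of i]]) simp
qed

text \<open>The tail bound for the rows of \<open>A\<close>, with \<open>L\<close> the squared
  spectral norm and sets of size \<open>n / K\<close>. Then \<mu> is the squared spectral norm
  divided by \<open>K\<close>, and the lower bound on \<open>K\<close> says exactly that \<mu> is at
  most the largest squared row length.\<close>

lemma card_large_subsample_le:
  fixes A :: "real^'d^'n"
  assumes A: "A \<noteq> 0" and K: "0 < K" "K dvd CARD('n)"
    and KR: "(spectral_norm A)\<^sup>2 / norm_1_2_transpose_sq A \<le> real K" and \<delta>: "0 < \<delta>"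
  shows "real (card {S. card S = CARD('n) div K \<and>
       (spectral_norm A)\<^sup>2 / K + \<delta> * norm_1_2_transpose_sq A < (spectral_norm (subsample S A))\<^sup>2}) \<le>
     real (CARD('n) choose (CARD('n) div K)) * real CARD('d) * (exp 1 / \<delta>) powr \<delta>"
proof -
  let ?t = "CARD('n) div K" and ?R = "norm_1_2_transpose_sq A" and ?s = "(spectral_norm A)\<^sup>2"
  let ?u = "?s / K + \<delta> * ?R"
  note R = norm_1_2_transpose_sq_pos[OF A] and s = spectral_norm_pos[OF A]
  have t: "0 < ?t" "?t \<le> CARD('n)"
    using K by (auto simp: div_greater_zero_iff intro: dvd_imp_le)
  have "real (card {S. card S = ?t \<and> ?u < (spectral_norm (subsample S A))\<^sup>2}) \<le>
      real (card {S. card S = ?t \<and> (\<exists>x. ?u * (x \<bullet> x) < (\<Sum>i\<in>S. (row i A \<bullet> x)\<^sup>2))})"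
  proof (intro of_nat_mono card_mono subsetI CollectI conjI)
    fix S assume S: "S \<in> {S. card S = ?t \<and> ?u < (spectral_norm (subsample S A))\<^sup>2}"
    then show "card S = ?t" by simp
    show "\<exists>x. ?u * (x \<bullet> x) < (\<Sum>i\<in>S. (row i A \<bullet> x)\<^sup>2)"
    proof (rule ccontr)
      assume "\<not> ?thesis"
      then have "(norm (subsample S A *v x))\<^sup>2 \<le> ?u * (x \<bullet> x)" for x
        unfolding norm_subsample_mult by (meson not_less)
      then have "(spectral_norm (subsample S A))\<^sup>2 \<le> ?u"
        using R \<delta> by (intro spectral_norm_sq_leI) auto
      then show False using S by simp
    qed
  qed simp
  also have "\<dots> \<le> real (CARD('n) choose ?t) * real DIM(real^'d) * (exp 1 / \<delta>) powr \<delta>"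
  proof (rule card_large_gram_powr_le)
    show "row i A \<bullet> row i A \<le> ?R" for i
      using norm_row_sq_le[of i A] by (simp add: power2_norm_eq_inner)
    show "(\<Sum>i\<in>UNIV. (row i A \<bullet> x)\<^sup>2) \<le> ?s * (x \<bullet> x)" for x
      using norm_mult_sq_le[of A x] by (simp add: norm_mult_rows)
    show "?s / real K = real ?t * (?s / real CARD('n))"
      using K by (simp add: real_of_nat_div field_simps)
    show "?s / real K \<le> ?R" using KR R K by (simp add: field_simps)
  qed (use R s t \<delta> in auto)
  finally show ?thesis by simp
qed

subsection \<open>Eigenvalues as roots of the characteristic polynomial\<close>

text \<open>Conjugating the characteristic matrix by the orthogonal matrix of eigenvectors, over the
  ring of polynomials, makes it diagonal with entries \<open>x - l\<close> for the eigenvalues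
  \<open>l\<close>; the determinant is unchanged.\<close>

lemma proots_charpoly:
  fixes H :: "real^'d^'d"
  assumes sym: "transpose H = H"
  obtains B where "eigenbasis ((*v) H) B"
    "proots (charpoly H) = image_mset (\<lambda>u. (H *v u) \<bullet> u) (mset_set B)"
proof -
  have adj: "(H *v x) \<bullet> y = x \<bullet> (H *v y)" for x y
    by (metis sym dot_lmul_matrix inner_commute vector_transpose_matrix)
  obtain B where B: "eigenbasis ((*v) H) B"
    using symmetric_eigenbasis[OF matrix_vector_mul_linear adj] by blast
  have fin: "finite B" using B by (simp add: eigenbasis_def)
  have "card B = CARD('d)" using card_eigenbasis[OF B] by simp
  then obtain b where b: "bij_betw b (UNIV :: 'd set) B"
    using fin by (metis finite_same_card_bij finite_class.finite_UNIV)
  let ?l = "\<lambda>i. (H *v b i) \<bullet> b i"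
  have orth: "b i \<bullet> b j = (if i = j then 1 else 0)" for i j
  proof (cases "i = j")
    case False
    then have "b i \<noteq> b j" "b i \<in> B" "b j \<in> B" using b by (auto simp: bij_betw_def inj_on_def)
    then show ?thesis using B False by (auto simp: eigenbasis_def pairwise_def orthogonal_def)
  qed (use B b in \<open>auto simp: eigenbasis_def bij_betw_def norm_eq_1\<close>)
  have eig: "H *v b i = ?l i *\<^sub>R b i" for i
    using B b unfolding eigenbasis_def bij_betw_def by auto
  \<comment> \<open>The rows of \<open>P\<close> are the eigenvectors, read as constant polynomials
    so that \<open>P\<close> can multiply the characteristic matrix \<open>C\<close>.\<close>
  define P :: "real poly^'d^'d" where "P = (\<chi> i j. [:b i $ j:])"
  define C :: "real poly^'d^'d" where "C = (\<chi> i j. (if i = j then [:0, 1:] else 0) - [:H $ i $ j:])"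
  have pc_sum: "(\<Sum>k\<in>UNIV. [:f k:]) = [:\<Sum>k\<in>UNIV. f k:]" for f :: "'d \<Rightarrow> real"
    by (simp add: poly_eq_iff coeff_sum coeff_pCons split: nat.split)
  have PP: "P ** transpose P = mat 1"
  proof -
    have "(P ** transpose P) $ i $ j = [:b i \<bullet> b j:]" for i j
      by (simp add: matrix_matrix_mult_def transpose_def P_def pc_sum inner_vec_def mult_ac)
    then show ?thesis by (simp add: vec_eq_iff mat_def orth)
  qed
  have PCP: "(P ** C ** transpose P) $ i $ j = (if i = j then [:- ?l i, 1:] else 0)" for i j
  proof -
    have CP: "(C ** transpose P) $ k $ j = [:0, 1:] * [:b j $ k:] - [:(H *v b j) $ k:]" for k
    proof -
      have "(C ** transpose P) $ k $ j =
          (\<Sum>m\<in>UNIV. (if k = m then [:0, 1:] * [:b j $ m:] else 0) - [:H $ k $ m * b j $ m:])"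
        unfolding matrix_matrix_mult_def transpose_def P_def C_def
        by (simp, intro sum.cong refl) (simp add: algebra_simps)
      then show ?thesis by (simp add: sum_subtractf pc_sum matrix_vector_mult_def)
    qed
    have "(P ** C ** transpose P) $ i $ j = (\<Sum>k\<in>UNIV. [:b i $ k:] * (C ** transpose P) $ k $ j)"
      unfolding matrix_mul_assoc[symmetric] matrix_matrix_mult_def[of P "C ** _"] by (simp add: P_def)
    also have "\<dots> = (\<Sum>k\<in>UNIV. [:0, 1:] * [:b i $ k * b j $ k:] - [:b i $ k * (H *v b j) $ k:])"
      unfolding CP by (intro sum.cong refl) (simp add: algebra_simps)
    also have "\<dots> = [:0, 1:] * [:b i \<bullet> b j:] - [:b i \<bullet> (H *v b j):]"
      by (simp only: sum_subtractf sum_distrib_left[symmetric] pc_sum) (simp add: inner_vec_def)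
    also have "b i \<bullet> (H *v b j) = ?l j * (b i \<bullet> b j)" by (subst eig) simp
    finally show ?thesis by (simp add: orth)
  qed
  have "charpoly H = det C" by (simp add: charpoly_def C_def)
  also have "\<dots> = det (P ** transpose P) * det C" by (simp add: PP det_I)
  also have "\<dots> = det (P ** C ** transpose P)" by (simp add: det_mul mult_ac)
  also have "\<dots> = (\<Prod>i\<in>UNIV. [:- ?l i, 1:])"
    by (subst det_diagonal) (simp_all add: PCP)
  finally have "proots (charpoly H) = (\<Sum>i\<in>UNIV. {#?l i#})"
    by (simp add: proots_prod)
  also have "\<dots> = image_mset ?l (mset_set UNIV)"
    by (simp add: sum_unfold_sum_mset)
  also have "\<dots> = image_mset (\<lambda>u. (H *v u) \<bullet> u) (image_mset b (mset_set UNIV))"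
    by (simp add: multiset.map_comp o_def)
  also have "image_mset b (mset_set UNIV) = mset_set B"
    using b by (simp add: bij_betw_def image_mset_mset_set)
  finally show thesis using that B by blast
qed

lemma sum_\<sigma>:
  assumes "size (proots (charpoly (H::real^'d^'d))) = m"
  shows "(\<Sum>i=1..m. \<sigma> H i) = sum_mset (proots (charpoly H))"
proof -
  let ?xs = "rev (sorted_list_of_multiset (proots (charpoly H)))"
  have len: "length ?xs = m"
    using assms by (metis length_rev mset_sorted_list_of_multiset size_mset)
  have "(\<Sum>i=1..m. \<sigma> H i) = (\<Sum>i<m. ?xs ! i)"
    unfolding \<sigma>_def by (intro sum.reindex_bij_witness[of _ Suc "\<lambda>i. i - 1"]) auto
  also have "\<dots> = sum_list ?xs" by (simp only: sum_list_sum_nth len atLeast0LessThan)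
  also have "\<dots> = sum_mset (proots (charpoly H))"
    by (metis mset_rev mset_sorted_list_of_multiset sum_mset_sum_list)
  finally show ?thesis .
qed

lemma \<sigma>_1:
  assumes "proots (charpoly (H::real^'d^'d)) \<noteq> {#}"
  shows "\<sigma> H 1 = Max (set_mset (proots (charpoly H)))"
proof -
  let ?ys = "sorted_list_of_multiset (proots (charpoly H))"
  have ne: "?ys \<noteq> []" using assms by (metis mset_sorted_list_of_multiset mset_zero_iff)
  have "\<sigma> H 1 = last ?ys" using ne by (simp add: \<sigma>_def hd_conv_nth[symmetric] hd_rev)
  also have "\<dots> = Max (set ?ys)"
  proof (rule Max_eqI[symmetric])
    fix y assume "y \<in> set ?ys"
    then obtain i where "i < length ?ys" "y = ?ys ! i" by (metis in_set_conv_nth)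
    then show "y \<le> last ?ys" using ne by (auto simp: last_conv_nth intro!: sorted_nth_mono)
  qed (use last_in_set[OF ne] in simp_all)
  finally show ?thesis by simp
qed

text \<open>The eigenvalues are the squared lengths of \<open>A *v u\<close> over an orthonormal
  eigenbasis. By Parseval their sum is the squared Frobenius norm, and their maximum is the maximum
  of the Rayleigh quotient.\<close>

lemma \<sigma>_gram:
  fixes A :: "real^'d^'n"
  shows "(\<Sum>i=1..CARD('d). \<sigma> (transpose A ** A) i) = (\<Sum>j\<in>UNIV. (norm (row j A))\<^sup>2)"
    and "\<sigma> (transpose A ** A) 1 = (spectral_norm A)\<^sup>2"
proof -
  let ?H = "transpose A ** A"
  have "x \<bullet> (?H *v x) = (norm (A *v x))\<^sup>2" for x
    by (metis dot_lmul_matrix matrix_vector_mul_assoc power2_norm_eq_inner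
        vector_transpose_matrix transpose_transpose)
  then have form: "(?H *v x) \<bullet> x = (norm (A *v x))\<^sup>2" for x
    by (simp only: inner_commute)
  have "transpose ?H = ?H" by (simp add: matrix_transpose_mul)
  from proots_charpoly[OF this] obtain B where B: "eigenbasis ((*v) ?H) B"
    and roots: "proots (charpoly ?H) = image_mset (\<lambda>u. (norm (A *v u))\<^sup>2) (mset_set B)"
    unfolding form by blast
  have fin: "finite B" using B by (simp add: eigenbasis_def)
  have card: "card B = CARD('d)" using card_eigenbasis[OF B] by simp
  have "(\<Sum>i=1..CARD('d). \<sigma> ?H i) = (\<Sum>u\<in>B. (norm (A *v u))\<^sup>2)"
    by (subst sum_\<sigma>) (simp_all add: roots card sum_unfold_sum_mset)
  also have "\<dots> = (\<Sum>j\<in>UNIV. \<Sum>u\<in>B. (row j A \<bullet> u)\<^sup>2)"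
    unfolding norm_mult_rows by (rule sum.swap)
  also have "\<dots> = (\<Sum>j\<in>UNIV. (norm (row j A))\<^sup>2)"
  proof (intro sum.cong refl)
    show "(\<Sum>u\<in>B. (row j A \<bullet> u)\<^sup>2) = (norm (row j A))\<^sup>2" for j
      unfolding power2_norm_eq_inner unfolding power2_eq_square by (rule eigenbasis_inner[OF B, symmetric])
  qed
  finally show "(\<Sum>i=1..CARD('d). \<sigma> ?H i) = (\<Sum>j\<in>UNIV. (norm (row j A))\<^sup>2)" .
  have ne: "B \<noteq> {}" using card by auto
  have "\<sigma> ?H 1 = Max ((\<lambda>u. (norm (A *v u))\<^sup>2) ` B)"
    using ne fin by (subst \<sigma>_1) (simp_all add: roots mset_set_empty_iff)
  also have "\<dots> = (spectral_norm A)\<^sup>2"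
  proof (rule antisym)
    show "Max ((\<lambda>u. (norm (A *v u))\<^sup>2) ` B) \<le> (spectral_norm A)\<^sup>2"
    proof (intro Max.boundedI)
      fix c assume "c \<in> (\<lambda>u. (norm (A *v u))\<^sup>2) ` B"
      then obtain u where "u \<in> B" "c = (norm (A *v u))\<^sup>2" by blast
      then show "c \<le> (spectral_norm A)\<^sup>2"
        using norm_mult_sq_le[of A u] B by (simp add: eigenbasis_def norm_eq_1)
    qed (use ne fin in auto)
    show "(spectral_norm A)\<^sup>2 \<le> Max ((\<lambda>u. (norm (A *v u))\<^sup>2) ` B)" (is "_ \<le> ?M")
    proof (rule spectral_norm_sq_leI)
      have M: "(norm (A *v u))\<^sup>2 \<le> ?M" if "u \<in> B" for u using that fin by simp
      show "0 \<le> ?M" using ne M by (metis all_not_in_conv order_trans zero_le_power2)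
      fix x
      have "(norm (A *v x))\<^sup>2 = x \<bullet> (((*v) ?H) ^^ 1) x" by (simp add: form[symmetric] inner_commute)
      also have "\<dots> = (\<Sum>u\<in>B. (x \<bullet> u)\<^sup>2 * (norm (A *v u))\<^sup>2)"
        unfolding eigenbasis_funpow[OF B matrix_vector_mul_linear] form by (simp add: power2_eq_square)
      also have "\<dots> \<le> (\<Sum>u\<in>B. (x \<bullet> u)\<^sup>2 * ?M)"
        by (intro sum_mono mult_left_mono M) auto
      also have "\<dots> = ?M * (x \<bullet> x)"
        by (simp add: eigenbasis_inner[OF B, of x x] power2_eq_square sum_distrib_right mult.commute[of "Max _"])
      finally show "(norm (A *v x))\<^sup>2 \<le> ?M * (x \<bullet> x)" .
    qed
  qed
  finally show "\<sigma> ?H 1 = (spectral_norm A)\<^sup>2" .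
qed

subsection \<open>Blocks of a random permutation\<close>

lemma blocks_map: "blocks K (map f xs) k = f ` blocks K xs k"
  by (simp add: blocks_def Let_def take_map drop_map)

lemma card_blocks:
  assumes "distinct xs" "k < K"
  shows "card (blocks K xs k) = length xs div K"
proof -
  let ?m = "length xs div K"
  have "Suc k * ?m \<le> K * ?m" using assms by (intro mult_le_mono1) simp
  also have "\<dots> \<le> length xs" by simp
  finally have "k * ?m + ?m \<le> length xs" by simp
  with assms(1) show ?thesis
    by (simp add: blocks_def Let_def distinct_card)
qed

text \<open>Position \<open>i\<close> lies in block \<open>i div ?m\<close> at offset
  \<open>i mod ?m\<close>; divisibility ensures that the blocks leave no remainder at the end of the
  list.\<close>

lemma UN_blocks:
  assumes "K dvd length xs" "0 < K"
  shows "(\<Union>k<K. blocks K xs k) = set xs"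
proof -
  let ?m = "length xs div K"
  have "xs ! i \<in> (\<Union>k<K. blocks K xs k)" if i: "i < length xs" for i
  proof -
    have m: "length xs = K * ?m" using assms by simp
    then have m0: "0 < ?m" using i by (metis gr0I mult_0_right not_less_zero)
    have k: "i div ?m < K" using i m m0 by (metis less_mult_imp_div_less)
    have "i mod ?m < length (take ?m (drop (i div ?m * ?m) xs))"
    proof -
      have "Suc (i div ?m) * ?m \<le> K * ?m" using k by (intro mult_le_mono1) simp
      then show ?thesis using m m0 by simp
    qed
    then have "take ?m (drop (i div ?m * ?m) xs) ! (i mod ?m) \<in> blocks K xs (i div ?m)"
      unfolding blocks_def Let_def by (rule nth_mem)
    moreover have "take ?m (drop (i div ?m * ?m) xs) ! (i mod ?m) = xs ! i"
      using m0 order.trans[OF div_times_less_eq_dividend less_imp_le[OF i]]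
      by (simp add: div_mult_mod_eq)
    ultimately show ?thesis using k by auto
  qed
  then show ?thesis
    by (auto simp: in_set_conv_nth blocks_def Let_def dest!: in_set_takeD in_set_dropD)
qed

text \<open>A bijection of \<open>T\<close> onto \<open>T'\<close>, extended to the complements,
  relabels permutations injectively and carries block \<open>T\<close> to block \<open>T'\<close>.
  Exchanging \<open>T\<close> and \<open>T'\<close> then gives equality.\<close>

lemma card_permutations_block_le:
  fixes T T' :: "'n::finite set"
  assumes "card T = card T'"
  shows "card {xs \<in> permutations_of_set UNIV. blocks K xs k = T} \<le>
    card {xs \<in> permutations_of_set UNIV. blocks K xs k = T'}"
proof -
  obtain f where f: "bij_betw f T T'"
    using assms by (metis finite finite_same_card_bij)
  obtain g where g: "bij_betw g (-T) (-T')"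
    using assms by (metis card_Diff_subset Compl_eq_Diff_UNIV finite finite_same_card_bij subset_UNIV)
  define h where "h = (\<lambda>x. if x \<in> T then f x else g x)"
  have "bij h" using bij_betw_disjoint_Un[OF f g] by (simp add: h_def)
  then have inj: "inj h" and surj: "range h = UNIV" by (auto simp: bij_def)
  have hT: "h ` T = T'" using f by (auto simp: h_def bij_betw_def)
  show ?thesis
  proof (rule card_inj_on_le[where f = "map h"])
    show "inj_on (map h) {xs \<in> permutations_of_set UNIV. blocks K xs k = T}"
      using inj by (intro inj_on_subset[OF inj_mapI]) auto
    show "map h ` {xs \<in> permutations_of_set UNIV. blocks K xs k = T} \<subseteq>
        {xs \<in> permutations_of_set UNIV. blocks K xs k = T'}"
      using inj surj hT
      by (auto simp: permutations_of_set_def blocks_map distinct_map inj_on_def)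
  qed simp
qed

text \<open>Each block is a uniformly random set of size \<open>m\<close>: by relabelling, all such
  sets arise from the same number \<open>c\<close> of permutations, and counting all permutations
  makes \<open>c\<close> cancel.\<close>

lemma prob_uniform_partition_block:
  fixes \<B> :: "'n::finite set set"
  assumes k: "k < K"
  defines "m \<equiv> CARD('n) div K"
  shows "measure_pmf.prob (uniform_partition K) {S. S k \<in> \<B>} =
     real (card {T\<in>\<B>. card T = m}) / real (CARD('n) choose m)"
proof -
  define P where "P = permutations_of_set (UNIV :: 'n set)"
  define N where "N T = card {xs\<in>P. blocks K xs k = T}" for T
  have fin: "finite P" by (simp add: P_def)
  have card_P: "card P = fact CARD('n)" by (simp add: P_def)
  have card_block: "card (blocks K xs k) = m" if "xs \<in> P" for xs
    using that k by (simp add: P_def card_blocks permutations_of_setD(2) length_finite_permutations_of_set m_def)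
  have count: "card {xs\<in>P. blocks K xs k \<in> \<A>} = (\<Sum>T | T \<in> \<A> \<and> card T = m. N T)" for \<A>
  proof -
    have "{xs\<in>P. blocks K xs k \<in> \<A>} = (\<Union>T\<in>{T. T \<in> \<A> \<and> card T = m}. {xs\<in>P. blocks K xs k = T})"
      using card_block by auto
    then show ?thesis
      unfolding N_def by (simp only:) (rule card_UN_disjoint, use fin in auto)
  qed
  obtain c where c: "\<And>T. card T = m \<Longrightarrow> N T = c"
  proof (cases "\<exists>T :: 'n set. card T = m")
    case True
    then obtain T0 :: "'n set" where "card T0 = m" by blast
    then have "N T = N T0" if "card T = m" for T
      using that unfolding N_def P_def by (intro antisym card_permutations_block_le) auto
    then show thesis using that by blast
  qed blast
  have "card {xs\<in>P. blocks K xs k \<in> UNIV} = (CARD('n) choose m) * c"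
    using n_subsets[of "UNIV :: 'n set" m] unfolding count by (simp add: c)
  then have total: "card P = (CARD('n) choose m) * c" by simp
  have "0 < card P" by (simp add: card_P)
  then have pos: "0 < c" "0 < CARD('n) choose m" unfolding total by auto
  have "measure_pmf.prob (uniform_partition K) {S. S k \<in> \<B>} = real (card {xs\<in>P. blocks K xs k \<in> \<B>}) / real (card P)"
    unfolding uniform_partition_def P_def
    by (simp add: measure_pmf_of_set permutations_of_set_empty_iff Int_def)
  also have "card {xs\<in>P. blocks K xs k \<in> \<B>} = card {T\<in>\<B>. card T = m} * c"
    unfolding count by (simp add: c)
  finally show ?thesis using pos by (simp add: total)
qed

subsection \<open>The Stochastic Acceleration factor\<close>

text \<open>The closed forms of the smoothness constants turn the factor into the squared norm of
  \<open>A\<close> over the largest squared block norm. Since the blocks cover all rows, one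
  contains a nonzero row, so this denominator is positive.\<close>

lemma SA_factor_ge:
  fixes A :: "real^'d^'n"
  assumes A: "A \<noteq> 0" and K: "0 < K" and S: "(\<Union>k<K. S k) = UNIV"
    and u: "\<And>k. k < K \<Longrightarrow> (spectral_norm (subsample (S k) A))\<^sup>2 \<le> u"
  shows "(spectral_norm A)\<^sup>2 / u \<le> SA_factor A b S K"
proof -
  let ?M = "MAX k\<in>{..<K}. (spectral_norm (subsample (S k) A))\<^sup>2"
  obtain i where i: "row i A \<noteq> 0" using nonzero_row[OF A] .
  obtain k where k: "k < K" "i \<in> S k" using S by blast
  have "row i (subsample (S k) A) = row i A" using k by (simp add: row_def subsample_def)
  with i have "subsample (S k) A \<noteq> 0" by (metis row_def vec_eq_iff vec_lambda_beta zero_index)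
  from spectral_norm_pos[OF this] have "0 < (spectral_norm (subsample (S k) A))\<^sup>2" by simp
  also have "\<dots> \<le> ?M" using k by (intro Max_ge) auto
  finally have M: "0 < ?M" .
  have "?M \<le> u" using K u by (intro Max.boundedI) auto
  then have "(spectral_norm A)\<^sup>2 / u \<le> (spectral_norm A)\<^sup>2 / ?M"
    using M by (intro divide_left_mono) auto
  also have "\<dots> = SA_factor A b S K"
    using K M by (simp add: SA_factor_def L_f_eq L_b_eq[OF K] spectral_norm_gram')
  finally show ?thesis .
qed

theorem theorem4p14:
  fixes A :: "real^'d^'n" and b :: "real^'n" and K :: nat and \<rho> \<delta> :: real
  assumes "A \<noteq> 0"
    and "1 \<le> \<rho>" "\<rho> \<le> real CARD('n)"
    and "Max (range (\<lambda>i. (norm (row i A))\<^sup>2))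
           / (1 / real CARD('n) * (\<Sum>j\<in>UNIV. (norm (row j A))\<^sup>2)) \<le> \<rho>"
    and "\<delta> > 0"
    and "K > 0" "K dvd CARD('n)"
    and "(spectral_norm A)\<^sup>2 / norm_1_2_transpose_sq A \<le> real K"
    and "K \<le> min CARD('n) CARD('d)"
  shows "measure_pmf.prob (uniform_partition K)
           {S. SA_factor A b S K
                 \<ge> 1 / (1 / real K + \<delta> * (norm_1_2_transpose_sq A / (spectral_norm A)\<^sup>2))
             \<and> 1 / (1 / real K + \<delta> * (norm_1_2_transpose_sq A / (spectral_norm A)\<^sup>2))
                 \<ge> 1 / (1 / real K + \<delta> * (\<rho> / real CARD('n))
                      * ((\<Sum>i=1..CARD('d). \<sigma> (transpose A ** A) i) / \<sigma> (transpose A ** A) 1))}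
         \<ge> 1 - (real CARD('d))\<^sup>2 * (exp 1 / \<delta>) powr \<delta>"
proof -
  let ?R = "norm_1_2_transpose_sq A" and ?s = "(spectral_norm A)\<^sup>2" and ?n = "real CARD('n)"
  let ?d = "real CARD('d)" and ?m = "CARD('n) div K" and ?p = "(exp 1 / \<delta>) powr \<delta>"
  let ?lo = "1 / (1 / real K + \<delta> * (?R / ?s))"
  let ?lo' = "1 / (1 / real K + \<delta> * (\<rho> / ?n)
      * ((\<Sum>i=1..CARD('d). \<sigma> (transpose A ** A) i) / \<sigma> (transpose A ** A) 1))"
  let ?u = "?s / K + \<delta> * ?R"
  define Large where "Large = {T. ?u < (spectral_norm (subsample T A))\<^sup>2}"
  note R = norm_1_2_transpose_sq_pos[OF assms(1)]
  have s: "0 < ?s" using spectral_norm_pos[OF assms(1)] by simp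
  have K: "0 < K" and \<delta>: "0 < \<delta>" by fact+
  have m: "?m \<le> CARD('n)" by simp
  have lo: "?s / ?u = ?lo" using s by (simp add: field_simps)
  \<comment> \<open>The second bound is deterministic: by \<open>\<sigma>_gram\<close> the
    eigenvalue ratio is the sum of squared row lengths over the squared spectral norm, and \<rho>
    compares that sum with the largest row.\<close>
  have lo': "?lo' \<le> ?lo"
  proof -
    let ?tr = "\<Sum>j\<in>UNIV. (norm (row j A))\<^sup>2"
    obtain i where "row i A \<noteq> 0" using nonzero_row[OF assms(1)] .
    then have tr: "0 < ?tr" by (intro sum_pos2[of _ i]) auto
    have "?R / (1 / ?n * ?tr) \<le> \<rho>" using assms(4) by (simp only: norm_1_2_transpose_sq_def)
    then have "?R \<le> \<rho> * (1 / ?n * ?tr)" using tr by (subst (asm) pos_divide_le_eq) auto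
    then have "?R / ?s \<le> \<rho> * (1 / ?n * ?tr) / ?s" using s by (intro divide_right_mono) auto
    then have "\<delta> * (?R / ?s) \<le> \<delta> * (\<rho> * (1 / ?n * ?tr) / ?s)" using \<delta> by (intro mult_left_mono) auto
    then have "1 / real K + \<delta> * (?R / ?s) \<le> 1 / real K + \<delta> * (\<rho> / ?n) * (?tr / ?s)" by simp
    moreover have "0 < 1 / real K + \<delta> * (?R / ?s)" using K \<delta> R s by (intro add_pos_pos) auto
    ultimately show ?thesis unfolding \<sigma>_gram by (intro divide_left_mono mult_pos_pos) auto
  qed
  have prob: "measure_pmf.prob (uniform_partition K) {S. S k \<in> Large} \<le> ?d * ?p" if "k < K" for k
  proof -
    have "real (card {T\<in>Large. card T = ?m}) \<le> real (CARD('n) choose ?m) * ?d * ?p"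
      using card_large_subsample_le[OF assms(1) K assms(7,8) \<delta>] by (simp add: Large_def conj_commute)
    then show ?thesis
      unfolding prob_uniform_partition_block[OF that] using m by (simp add: field_simps)
  qed
  let ?E = "{S. ?lo \<le> SA_factor A b S K \<and> ?lo' \<le> ?lo}"
  let ?F = "\<Union>k<K. {S. S k \<in> Large}"
  \<comment> \<open>Union bound over the \<open>K\<close> blocks; \<open>K \<le> d\<close> then
    replaces \<open>K * d\<close> by the square of \<open>d\<close>.\<close>
  have "measure_pmf.prob (uniform_partition K) ?F \<le>
      (\<Sum>k<K. measure_pmf.prob (uniform_partition K) {S. S k \<in> Large})"
    by (intro measure_pmf.finite_measure_subadditive_finite) auto
  also have "\<dots> \<le> (\<Sum>k<K. ?d * ?p)" by (intro sum_mono prob) simp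
  also have "\<dots> = real K * (?d * ?p)" by simp
  also have "\<dots> \<le> ?d * (?d * ?p)" using assms(9) by (intro mult_right_mono) auto
  finally have F: "measure_pmf.prob (uniform_partition K) ?F \<le> ?d\<^sup>2 * ?p"
    by (simp add: power2_eq_square mult.assoc)
  have "1 - ?d\<^sup>2 * ?p \<le> measure_pmf.prob (uniform_partition K) (- ?F)"
    using F measure_pmf.prob_compl[of ?F "uniform_partition K"] by (simp add: Compl_eq_Diff_UNIV)
  \<comment> \<open>On the support, \<open>S\<close> comes from a permutation, so its blocks cover
    the index set as \<open>SA_factor_ge\<close> requires.\<close>
  also have "\<dots> = measure_pmf.prob (uniform_partition K) (- ?F \<inter> set_pmf (uniform_partition K))"
    by (rule measure_Int_set_pmf[symmetric])
  also have "\<dots> \<le> measure_pmf.prob (uniform_partition K) ?E"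
  proof (intro measure_pmf.finite_measure_mono subsetI CollectI conjI lo')
    fix S :: "nat \<Rightarrow> 'n set" assume S: "S \<in> - ?F \<inter> set_pmf (uniform_partition K)"
    then obtain xs :: "'n list" where xs: "xs \<in> permutations_of_set UNIV" "S = blocks K xs"
      by (auto simp: uniform_partition_def)
    have "(\<Union>k<K. S k) = UNIV"
      using UN_blocks[of K xs] xs assms(7) K
      by (simp add: length_finite_permutations_of_set permutations_of_setD(1))
    moreover have "(spectral_norm (subsample (S k) A))\<^sup>2 \<le> ?u" if "k < K" for k
      using S that by (auto simp: Large_def not_less)
    ultimately have "?s / ?u \<le> SA_factor A b S K"
      by (intro SA_factor_ge assms(1) K)
    then show "?lo \<le> SA_factor A b S K" by (simp only: lo)
  qed simp
  finally show ?thesis .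
qed

end
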